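(* Let $\zeta$ be a transcendental real number. Then $\zeta$ is a $U$-number if and only if $\lim_{n\to\infty}\lambda_n(\zeta)>0$. More precisely, if $\zeta$ is a $U_m$-number, then $\lambda_n(\zeta)=\frac{1}{m-1}$ for all sufficiently large $n$. Moreover, $\zeta$ is a $T$-number if and only if \[\lim_{n\to\infty}\lambda_n(\zeta)=0\quad\text{and}\quad \limsup_{n\to\infty} n\lambda_n(\zeta)=\infty.\] Finally, $\zeta$ is an $S$-number if and only if $\limsup_{n\to\infty} n\lambda_n(\zeta)<\infty$.
   Context: For an integer polynomial $P$, $H(P)$ denotes the maximum modulus of its coefficients. For $n\ge 1$, $w_n(\zeta)$ is the supremum of $w$ such that $0<|P(\zeta)|\le H(P)^{-w}$ has infinitely many solutions $P\in\mathbb{Z}[T]$ of degree at most $n$. $\lambda_n(\zeta)$ is the supremum of $\lambda$ such that the system $1\le |x|\le X$, $\max_{1\le i\le n}|\zeta^i x-y_i|\le X^{-\lambda}$ has a solution $(x,y_1,\dots,y_n)\in\mathbb{Z}^{n+1}$ for arbitrarily large $X$; the sequence $(\lambda_n(\zeta))_{n\ge1}$ is non-increasing, so its limit exists in $[0,\infty]$. Mahler's classification: $\zeta$ is a $U_m$-number if $w_m(\zeta)=\infty$ and $m$ is the smallest such index; a $U$-number is a $U_m$-number for some $m\ge1$; $\zeta$ is a $T$-number if $w_n(\zeta)<\infty$ for all $n$ but $\limsup_{n\to\infty}w_n(\zeta)/n=\infty$; $\zeta$ is an $S$-number if $\limsup_{n\to\infty} w_n(\zeta)/n<\infty$. Convention: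 $1/0=\infty$, $1/\infty=0$. *)

theory Defs
  imports Complex_Main "HOL-Library.Extended_Real" "HOL-Computational_Algebra.Polynomial"
begin

definition height :: "int poly \<Rightarrow> int" where
  "height P = Max ((\<lambda>i. \<bar>coeff P i\<bar>) ` {..degree P})"

text \<open>The exponents are meant for \<open>n \<ge> 1\<close>. They are extended reals, since they may be
  infinite. In particular \<open>1 / 0 = \<infinity>\<close> and \<open>1 / \<infinity> = 0\<close> hold for them.\<close>

definition w_exp :: "nat \<Rightarrow> real \<Rightarrow> ereal" where
  "w_exp n \<zeta> = Sup {ereal w | w :: real.
     infinite {P :: int poly. degree P \<le> n \<and>
       0 < \<bar>poly (map_poly real_of_int P) \<zeta>\<bar> \<and>
       \<bar>poly (map_poly real_of_int P) \<zeta>\<bar> \<le> real_of_int (height P) powr (- w)}}"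

definition lambda_exp :: "nat \<Rightarrow> real \<Rightarrow> ereal" where
  "lambda_exp n \<zeta> = Sup {ereal l | l :: real.
     \<forall>X0 :: real. \<exists>X \<ge> X0. \<exists>(x :: int) (y :: nat \<Rightarrow> int).
       1 \<le> \<bar>x\<bar> \<and> real_of_int \<bar>x\<bar> \<le> X \<and>
       Max ((\<lambda>i. \<bar>\<zeta> ^ i * real_of_int x - real_of_int (y i)\<bar>) ` {1..n}) \<le> X powr (- l)}"

definition U_index :: "nat \<Rightarrow> real \<Rightarrow> bool" where
  "U_index m \<zeta> \<longleftrightarrow> 1 \<le> m \<and> w_exp m \<zeta> = \<infinity> \<and> (\<forall>k. 1 \<le> k \<and> k < m \<longrightarrow> w_exp k \<zeta> \<noteq> \<infinity>)"

definition U_number :: "real \<Rightarrow> bool" where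
  "U_number \<zeta> \<longleftrightarrow> (\<exists>m \<ge> 1. U_index m \<zeta>)"

definition T_number :: "real \<Rightarrow> bool" where
  "T_number \<zeta> \<longleftrightarrow> (\<forall>n \<ge> 1. w_exp n \<zeta> < \<infinity>) \<and>
     limsup (\<lambda>n. w_exp n \<zeta> / ereal (real n)) = \<infinity>"

definition S_number :: "real \<Rightarrow> bool" where
  "S_number \<zeta> \<longleftrightarrow> limsup (\<lambda>n. w_exp n \<zeta> / ereal (real n)) < \<infinity>"

end

theory Submission
  imports Defs "HOL-Computational_Algebra.Polynomial_Factorial" "HOL-Library.FuncSet"
begin

text \<open>
  Two elementary transference statements carry the whole theorem.

  (A) If \<open>\<lambda>\<^sub>N > 1/m\<close> and \<open>N \<ge> 2m\<close>, then \<open>w\<^sub>m \<ge> N - m - 1\<close>. A good approximation \<open>(x, y\<^sub>1, \<dots>, y\<^sub>N)\<close> defines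
  the functional \<open>T\<^sup>i \<mapsto> y\<^sub>i\<close> (with \<open>y\<^sub>0 = x\<close>). Dirichlet's theorem yields polynomials \<open>P\<close> of degree at most \<open>m\<close>
  and \<open>Q\<close> of degree at most \<open>N - m\<close> whose multiples up to degree \<open>N\<close> take integer values of modulus
  less than 1 under this functional, hence are annihilated. By Bezout so is a common divisor \<open>G\<close>, and
  its height is bounded in terms of that of \<open>Q\<close>, which is about \<open>\<bar>x\<bar>\<close> to the power \<open>1/(N - m)\<close>; but
  annihilation forces \<open>\<bar>G(\<zeta>)\<bar>\<close> to be smaller than \<open>1/\<bar>x\<bar>\<close>.

  (B) If \<open>w\<^sub>m > M + ms\<close> with \<open>M = N - m + 1\<close>, then \<open>\<lambda>\<^sub>N \<ge> s/(M + s(m - 1))\<close>. Given \<open>P\<close> of degree at most \<open>m\<close>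
  with \<open>P(\<zeta>)\<close> small, one finds by the pigeonhole principle an integer vector annihilated by all
  multiples of \<open>P\<close> up to degree \<open>N\<close> with \<open>m - 1\<close> of its coordinates well approximated; the
  recurrence with coefficients from \<open>P\<close> propagates this to all coordinates.
\<close>

section \<open>Heights of integer polynomials\<close>

abbreviation ipoly :: "int poly \<Rightarrow> real \<Rightarrow> real" where
  "ipoly P x \<equiv> poly (map_poly real_of_int P) x"

lemma coeff_abs_le_height: "\<bar>coeff P i\<bar> \<le> height P"
proof (cases "i \<le> degree P")
  case True
  then show ?thesis unfolding height_def by (intro Max_ge) auto
next
  case False
  have "\<bar>coeff P (degree P)\<bar> \<le> height P" unfolding height_def by (intro Max_ge) auto
  then show ?thesis using False by (simp add: coeff_eq_0)
qed

lemma height_le: "(\<And>i. \<bar>coeff P i\<bar> \<le> h) \<Longrightarrow> height P \<le> h"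
  unfolding height_def by (subst Max_le_iff) auto

lemma height_pos: "P \<noteq> 0 \<Longrightarrow> 1 \<le> height P"
  using coeff_abs_le_height[of P "degree P"] leading_coeff_neq_0[of P] by linarith

lemma poly_eq_sum_coeffs:
  fixes p :: "'a :: comm_semiring_1 poly"
  assumes "degree p \<le> n"
  shows "poly p x = (\<Sum>i\<le>n. coeff p i * x ^ i)"
  unfolding poly_altdef
  by (rule sum.mono_neutral_left) (use assms in \<open>auto simp: coeff_eq_0 not_le\<close>)

lemma ipoly_eq_sum_coeffs:
  assumes "degree P \<le> n"
  shows "ipoly P x = (\<Sum>i\<le>n. real_of_int (coeff P i) * x ^ i)"
  using poly_eq_sum_coeffs[of "map_poly real_of_int P" n x] assms
  by (simp add: coeff_map_poly degree_map_poly)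

lemma ipoly_of_int: "ipoly P (real_of_int b) = real_of_int (poly P b)"
  using ipoly_eq_sum_coeffs[of P "degree P"] poly_altdef[of P b] by simp

lemma ipoly_diff: "ipoly (P - Q) x = ipoly P x - ipoly Q x"
proof -
  define n where "n = max (degree P) (degree Q)"
  have "degree P \<le> n" "degree Q \<le> n" "degree (P - Q) \<le> n"
    using degree_diff_le[of P n Q] by (auto simp: n_def)
  then show ?thesis
    by (simp add: ipoly_eq_sum_coeffs[of _ n] sum_subtractf left_diff_distrib)
qed

lemma ipoly_neq_0:
  assumes "\<not> algebraic x" "P \<noteq> 0"
  shows "ipoly P x \<noteq> 0"
proof
  assume "ipoly P x = 0"
  moreover have "map_poly real_of_int P \<noteq> 0" using assms(2) by (simp add: map_poly_eq_0_iff)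
  moreover have "coeff (map_poly real_of_int P) i \<in> \<int>" for i by (simp add: coeff_map_poly)
  ultimately show False using assms(1) algebraicI by blast
qed

lemma ipoly_abs_le:
  assumes "degree P \<le> n"
  shows "\<bar>ipoly P x\<bar> \<le> real_of_int (height P) * (\<Sum>i\<le>n. \<bar>x\<bar> ^ i)"
proof -
  have "\<bar>ipoly P x\<bar> \<le> (\<Sum>i\<le>n. \<bar>real_of_int (coeff P i) * x ^ i\<bar>)"
    unfolding ipoly_eq_sum_coeffs[OF assms] by (rule sum_abs)
  also have "\<dots> \<le> (\<Sum>i\<le>n. real_of_int (height P) * \<bar>x\<bar> ^ i)"
  proof (intro sum_mono)
    fix i
    have "\<bar>real_of_int (coeff P i)\<bar> \<le> real_of_int (height P)"
      using coeff_abs_le_height[of P i] by linarith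
    then show "\<bar>real_of_int (coeff P i) * x ^ i\<bar> \<le> real_of_int (height P) * \<bar>x\<bar> ^ i"
      by (simp add: abs_mult power_abs mult_right_mono)
  qed
  finally show ?thesis by (simp add: sum_distrib_left)
qed

lemma finite_bounded_degree_height:
  "finite {P :: int poly. degree P \<le> n \<and> height P \<le> h}"
proof (rule finite_subset)
  let ?S = "{xs :: int list. set xs \<subseteq> {-h..h} \<and> length xs \<le> Suc n}"
  show "{P :: int poly. degree P \<le> n \<and> height P \<le> h} \<subseteq> Poly ` ?S"
  proof
    fix P :: "int poly" assume "P \<in> {P. degree P \<le> n \<and> height P \<le> h}"
    then have P: "degree P \<le> n" "height P \<le> h" by auto
    have "set (coeffs P) \<subseteq> {-h..h}"
    proof
      fix c assume "c \<in> set (coeffs P)"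
      then obtain i where "c = coeff P i" by (auto simp: coeffs_def split: if_splits)
      then show "c \<in> {-h..h}" using coeff_abs_le_height[of P i] P by auto
    qed
    moreover have "length (coeffs P) \<le> Suc n" using P by (simp add: coeffs_def)
    ultimately show "P \<in> Poly ` ?S" by (intro image_eqI[of _ _ "coeffs P"]) auto
  qed
  show "finite (Poly ` ?S)" by (intro finite_imageI finite_lists_length_le) auto
qed

section \<open>Interpolation at integer points\<close>

text \<open>Induction on \<open>n\<close>, splitting off one node \<open>b\<close>: synthetic
  division writes \<open>p\<close> as (T - b) q + p(b), and since distinct integers are at least 1
  apart, \<open>q\<close> is bounded by \<open>2 * M\<close> at the remaining nodes. The constant is
  uniform in \<open>B\<close> because all nodes lie in \<open>{0..K}\<close>.\<close>

lemma coeff_bound_of_values: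
  fixes K :: int
  assumes "0 \<le> K"
  shows "\<exists>C\<ge>1. \<forall>(p :: real poly) B M.
     degree p \<le> n \<longrightarrow> B \<subseteq> {0..K} \<longrightarrow> card B = Suc n \<longrightarrow>
     (\<forall>b\<in>B. \<bar>poly p (real_of_int b)\<bar> \<le> M) \<longrightarrow> (\<forall>i. \<bar>coeff p i\<bar> \<le> C * M)"
proof (induction n)
  case 0
  have "\<bar>coeff p i\<bar> \<le> M" if p: "degree p = 0" and B: "card B = Suc 0"
      "\<forall>b\<in>B. \<bar>poly p (real_of_int b)\<bar> \<le> M"
    for p :: "real poly" and B :: "int set" and M i
  proof -
    obtain a where a: "p = [:a:]" using p by (metis degree_eq_zeroE)
    obtain b where "b \<in> B" using B(1) by fastforce
    then have "\<bar>a\<bar> \<le> M" using B(2) a by auto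
    then show ?thesis using a by (cases i) auto
  qed
  then show ?case by (intro exI[of _ 1]) auto
next
  case (Suc n)
  then obtain C where C: "C \<ge> 1" and IH: "\<And>(p :: real poly) B M i. degree p \<le> n \<Longrightarrow>
      B \<subseteq> {0..K} \<Longrightarrow> card B = Suc n \<Longrightarrow>
      (\<forall>b\<in>B. \<bar>poly p (real_of_int b)\<bar> \<le> M) \<Longrightarrow> \<bar>coeff p i\<bar> \<le> C * M" by metis
  \<comment> \<open>Each coefficient of \<open>p\<close> is -b times a coefficient of
    \<open>q\<close>, plus the preceding coefficient of \<open>q\<close>, plus possibly p(b); these
    contribute at most K * 2CM, 2CM and M.\<close>
  define D where "D = (real_of_int K + 1) * (2 * C) + 1"
  have D: "D \<ge> 1" unfolding D_def using C assms by auto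
  have "\<bar>coeff p i\<bar> \<le> D * M"
    if p: "degree p \<le> Suc n" and B: "B \<subseteq> {0..K}" "card B = Suc (Suc n)"
      "\<forall>b\<in>B. \<bar>poly p (real_of_int b)\<bar> \<le> M"
    for p :: "real poly" and B :: "int set" and M i
  proof -
    obtain b where b: "b \<in> B" using B(2) by fastforce
    define q where "q = synthetic_div p (real_of_int b)"
    have pq: "p = [:- real_of_int b, 1:] * q + [:poly p (real_of_int b):]"
      unfolding q_def by (rule synthetic_div_correct'[symmetric])
    have M0: "0 \<le> M" using B(3) b abs_ge_zero order_trans by blast
    have dq: "degree q \<le> n" unfolding q_def degree_synthetic_div using p by simp
    have qv: "\<bar>poly q (real_of_int c)\<bar> \<le> 2 * M" if c: "c \<in> B - {b}" for c
    proof -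
      have "poly p (real_of_int c) = (real_of_int c - real_of_int b) * poly q (real_of_int c)
          + poly p (real_of_int b)"
        by (subst pq) (simp add: algebra_simps)
      then have "\<bar>real_of_int c - real_of_int b\<bar> * \<bar>poly q (real_of_int c)\<bar>
          = \<bar>poly p (real_of_int c) - poly p (real_of_int b)\<bar>"
        by (simp flip: abs_mult)
      moreover have "\<bar>poly p (real_of_int c)\<bar> \<le> M" "\<bar>poly p (real_of_int b)\<bar> \<le> M"
        using B(3) c b by auto
      ultimately have "\<bar>real_of_int c - real_of_int b\<bar> * \<bar>poly q (real_of_int c)\<bar> \<le> 2 * M"
        by linarith
      moreover have "1 \<le> \<bar>c - b\<bar>" using c by auto
      then have "1 \<le> \<bar>real_of_int c - real_of_int b\<bar>" by linarith
      then have "1 * \<bar>poly q (real_of_int c)\<bar>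
          \<le> \<bar>real_of_int c - real_of_int b\<bar> * \<bar>poly q (real_of_int c)\<bar>"
        by (rule mult_right_mono) auto
      ultimately show ?thesis by linarith
    qed
    have cB: "card (B - {b}) = Suc n" using B b by (simp add: card_Diff_singleton)
    have qc: "\<bar>coeff q j\<bar> \<le> C * (2 * M)" for j
      using IH[OF dq _ cB] qv B by auto
    have bK: "\<bar>real_of_int b\<bar> \<le> real_of_int K" using b B(1) by auto
    have "\<bar>real_of_int b * coeff q i\<bar> \<le> real_of_int K * (C * (2 * M))"
      unfolding abs_mult using bK qc by (intro mult_mono) auto
    moreover have "\<bar>coeff (pCons 0 q) i\<bar> \<le> C * (2 * M)"
      using qc M0 C by (cases i) auto
    moreover have "\<bar>coeff [:poly p (real_of_int b):] i\<bar> \<le> M"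
      using B(3) b M0 by (cases i) auto
    moreover have "coeff p i = - (real_of_int b * coeff q i) + coeff (pCons 0 q) i
        + coeff [:poly p (real_of_int b):] i"
      by (subst pq, cases i) (simp_all add: algebra_simps)
    ultimately have "\<bar>coeff p i\<bar> \<le> real_of_int K * (C * (2 * M)) + C * (2 * M) + M"
      by linarith
    then show ?thesis unfolding D_def by (simp add: algebra_simps)
  qed
  then show ?case using D by blast
qed

lemma height_bound_of_values:
  fixes K :: int
  assumes "0 \<le> K"
  shows "\<exists>C\<ge>1. \<forall>P B M. degree P \<le> n \<longrightarrow> B \<subseteq> {0..K} \<longrightarrow> card B = Suc n \<longrightarrow>
     (\<forall>b\<in>B. real_of_int \<bar>poly P b\<bar> \<le> M) \<longrightarrow> real_of_int (height P) \<le> C * M"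
proof -
  obtain C where "C \<ge> 1" and C: "\<And>(p :: real poly) B M i. degree p \<le> n \<Longrightarrow>
      B \<subseteq> {0..K} \<Longrightarrow> card B = Suc n \<Longrightarrow>
      (\<forall>b\<in>B. \<bar>poly p (real_of_int b)\<bar> \<le> M) \<Longrightarrow> \<bar>coeff p i\<bar> \<le> C * M"
    using coeff_bound_of_values[OF assms, of n] by metis
  have "real_of_int (height P) \<le> C * M"
    if P: "degree P \<le> n" and B: "B \<subseteq> {0..K}" "card B = Suc n"
      "\<forall>b\<in>B. real_of_int \<bar>poly P b\<bar> \<le> M" for P B M
  proof -
    have *: "\<bar>real_of_int (coeff P i)\<bar> \<le> C * M" for i
    proof -
      have "degree (map_poly real_of_int P) \<le> n"
        using P by (simp add: degree_map_poly)
      from C[OF this B(1,2), of M i] B(3) show ?thesis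
        by (simp add: ipoly_of_int coeff_map_poly)
    qed
    have "height P \<le> \<lfloor>C * M\<rfloor>"
      using * by (intro height_le) (simp add: le_floor_iff)
    then show ?thesis by linarith
  qed
  then show ?thesis using \<open>C \<ge> 1\<close> by blast
qed

text \<open>The cofactor takes nonzero integer values at all but few of the points \<open>0,\<dots>,2n\<close>, and there
  the factor is bounded by the product; interpolation does the rest.\<close>

lemma height_factor_le:
  "\<exists>C\<ge>1. \<forall>G P. P \<noteq> 0 \<longrightarrow> degree P \<le> n \<longrightarrow> G dvd P \<longrightarrow>
     real_of_int (height G) \<le> C * real_of_int (height P)"
proof -
  obtain C where C1: "C \<ge> 1" and C: "\<And>P B M. degree P \<le> n \<Longrightarrow> B \<subseteq> {0..2 * int n} \<Longrightarrow>
      card B = Suc n \<Longrightarrow> (\<forall>b\<in>B. real_of_int \<bar>poly P b\<bar> \<le> M) \<Longrightarrow>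
      real_of_int (height P) \<le> C * M"
    using height_bound_of_values[of "2 * int n" n] by force
  \<comment> \<open>\<open>E\<close> bounds the sum of the powers of every point of
    \<open>{0..2n}\<close>, so \<open>P\<close> is bounded there by
    \<open>height P * E\<close>.\<close>
  define E where "E = (\<Sum>i\<le>n. (2 * real n) ^ i)"
  have E: "E \<ge> 1"
  proof -
    have "(\<Sum>i\<in>{0}. (2 * real n) ^ i) \<le> E" unfolding E_def by (rule sum_mono2) auto
    then show ?thesis by simp
  qed
  have "real_of_int (height G) \<le> (C * E) * real_of_int (height P)"
    if P: "P \<noteq> 0" "degree P \<le> n" "G dvd P" for G P
  proof -
    obtain S where S: "P = G * S" using P(3) by blast
    have nz: "G \<noteq> 0" "S \<noteq> 0" using S P(1) by auto
    have dG: "degree G \<le> n" and dS: "degree S \<le> n"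
      using S P(2) nz by (auto simp: degree_mult_eq)
    let ?A = "{0..2 * int n}"
    have fin: "finite {b. poly S b = 0}" using nz poly_roots_finite by blast
    have "card {b. poly S b = 0} \<le> n" using card_poly_roots_bound[OF nz(2)] dS by simp
    moreover have "card (?A - {b. poly S b = 0}) \<ge> card ?A - card {b. poly S b = 0}"
      by (rule diff_card_le_card_Diff[OF fin])
    \<comment> \<open>Of the 2n + 1 points at most n are roots of the cofactor, which leaves the n +
      1 nodes that interpolation in degree \<open>n\<close> requires.\<close>
    ultimately have "Suc n \<le> card (?A - {b. poly S b = 0})" by simp
    then obtain B where B: "B \<subseteq> ?A - {b. poly S b = 0}" "card B = Suc n"
      by (meson obtain_subset_with_card_n)
    have "\<forall>b\<in>B. real_of_int \<bar>poly G b\<bar> \<le> real_of_int (height P) * E"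
    proof
      fix b assume b: "b \<in> B"
      then have "1 \<le> \<bar>poly S b\<bar>" using B(1) by auto
      then have "\<bar>poly G b\<bar> * 1 \<le> \<bar>poly G b\<bar> * \<bar>poly S b\<bar>" by (intro mult_left_mono) auto
      then have "real_of_int \<bar>poly G b\<bar> \<le> \<bar>ipoly P (real_of_int b)\<bar>"
        unfolding ipoly_of_int S poly_mult abs_mult[symmetric] by linarith
      also have "\<dots> \<le> real_of_int (height P) * (\<Sum>i\<le>n. \<bar>real_of_int b\<bar> ^ i)"
        by (rule ipoly_abs_le[OF P(2)])
      also have "\<dots> \<le> real_of_int (height P) * E" unfolding E_def
        using b B(1) height_pos[OF P(1)] by (intro mult_left_mono sum_mono power_mono) auto
      finally show "real_of_int \<bar>poly G b\<bar> \<le> real_of_int (height P) * E" .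
    qed
    from C[OF dG _ B(2) this] B(1) show ?thesis by (auto simp: algebra_simps)
  qed
  moreover have "C * E \<ge> 1" using C1 E mult_mono[of 1 C 1 E] by simp
  ultimately show ?thesis by blast
qed

section \<open>Bezout identities with degree bounds\<close>

text \<open>A nonzero element of least degree in the ideal generated by \<open>p\<close> and
  \<open>q\<close> divides every member: the remainder is again in the ideal and has smaller degree,
  so it vanishes.\<close>

lemma field_poly_bezout:
  fixes p q :: "'a :: field poly"
  assumes "p \<noteq> 0"
  shows "\<exists>g a b. g \<noteq> 0 \<and> g dvd p \<and> g dvd q \<and> a * p + b * q = g"
proof -
  define I where "I = {g. g \<noteq> 0 \<and> (\<exists>a b. g = a * p + b * q)}"
  have "p = 1 * p + 0 * q" by simp
  then have "p \<in> I" unfolding I_def using assms by blast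
  then obtain g where g: "g \<in> I" and min: "\<And>h. h \<in> I \<Longrightarrow> degree g \<le> degree h"
    using arg_min_nat_lemma[of "\<lambda>x. x \<in> I" p degree] by blast
  obtain a b where ab: "g = a * p + b * q" "g \<noteq> 0" using g by (auto simp: I_def)
  have dvd: "g dvd r" if r: "r = c * p + d * q" for r c d
  proof -
    have "r mod g = r - (r div g) * g" by (simp add: minus_div_mult_eq_mod)
    also have "\<dots> = (c - (r div g) * a) * p + (d - (r div g) * b) * q"
      unfolding r by (subst (2) ab(1)) (simp add: algebra_simps)
    finally have "r mod g \<in> I" if "r mod g \<noteq> 0" using that unfolding I_def by blast
    then have "r mod g = 0" using min degree_mod_less[OF ab(2), of r] by (meson not_le)
    then show ?thesis by blast
  qed
  have "p = 1 * p + 0 * q" "q = 0 * p + 1 * q" by auto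
  then have "g dvd p" "g dvd q" using dvd by blast+
  then show ?thesis using ab by metis
qed

text \<open>After division by \<open>g\<close> the cofactors \<open>p'\<close> and \<open>q'\<close>
  satisfy an identity with value 1. Reducing the first coefficient modulo \<open>q'\<close> bounds
  its degree, and the identity then forces the bound for the second.\<close>

lemma field_poly_bezout_degree_bounds:
  fixes p q :: "'a :: field poly"
  assumes "p \<noteq> 0" "q \<noteq> 0"
  shows "\<exists>g a b. g \<noteq> 0 \<and> g dvd p \<and> g dvd q \<and> a * p + b * q = g \<and>
    degree a \<le> degree q \<and> degree b \<le> degree p"
proof -
  obtain g u v where g0: "g \<noteq> 0" and gd: "g dvd p" "g dvd q" and g: "u * p + v * q = g"
    using field_poly_bezout[OF assms(1)] by metis
  obtain p' q' where pq: "p = g * p'" "q = g * q'" using gd by (metis dvdE)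
  have nz: "p' \<noteq> 0" "q' \<noteq> 0" using pq assms by auto
  have "g * (u * p' + v * q') = g * 1" using g unfolding pq by (simp add: algebra_simps)
  then have uv: "u * p' + v * q' = 1" using g0 by (metis mult_left_cancel)
  \<comment> \<open>Removing (u div q') * q' from \<open>u\<close> is compensated by adding (u div
    q') * p' to \<open>v\<close>.\<close>
  define a where "a = u mod q'"
  define b where "b = v + (u div q') * p'"
  have "a * p' + b * q' = (u div q' * q' + u mod q') * p' + v * q'"
    unfolding a_def b_def by (simp only: distrib_right distrib_left mult_ac add_ac)
  also have "u div q' * q' + u mod q' = u" by (rule div_mult_mod_eq)
  finally have ab: "a * p' + b * q' = 1" using uv by simp
  have da: "a = 0 \<or> degree a < degree q'" unfolding a_def using degree_mod_less[OF nz(2)] by blast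
  have db: "degree b \<le> degree p'"
  proof (cases "b = 0")
    case False
    have "b * q' = 1 - a * p'" using ab by (simp add: algebra_simps)
    moreover have "degree (1 - a * p') \<le> degree q' + degree p'"
      using da nz by (intro degree_diff_le) (auto intro: order_trans[OF degree_mult_le])
    ultimately have "degree b + degree q' \<le> degree q' + degree p'"
      using False nz by (metis degree_mult_eq)
    then show ?thesis by simp
  qed auto
  have "a * p + b * q = g * (a * p' + b * q')" unfolding pq by (simp add: algebra_simps)
  then have "a * p + b * q = g" using ab by simp
  moreover have "degree a \<le> degree q" "degree b \<le> degree p"
    using da db g0 nz unfolding pq by (auto simp: degree_mult_eq)
  ultimately show ?thesis using g0 gd by blast
qed

text \<open>The identity over the fraction field is cleared of denominators. \<open>G\<close> is the
  primitive part of the field divisor, so Gauss's lemma gives divisibility over the integers. The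
  degree bounds later keep \<open>A * P\<close> and \<open>B * Q\<close> among the multiples known
  to be annihilated.\<close>

lemma int_poly_bezout_degree_bounds:
  fixes P Q :: "int poly"
  assumes "P \<noteq> 0" "Q \<noteq> 0"
  obtains G A B :: "int poly" and k :: int where
    "G dvd P" "G dvd Q" "k \<noteq> 0" "smult k G = A * P + B * Q"
    "degree A \<le> degree Q" "degree B \<le> degree P"
proof -
  let ?f = "\<lambda>p :: int poly. map_poly to_fract p"
  have deg: "degree (?f p) = degree p" for p by (rule degree_map_poly) simp
  have nz: "?f P \<noteq> 0" "?f Q \<noteq> 0" using assms by auto
  obtain g a b where g: "g \<noteq> 0" "g dvd ?f P" "g dvd ?f Q" and ab: "a * ?f P + b * ?f Q = g"
    and dab: "degree a \<le> degree Q" "degree b \<le> degree P"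
    using field_poly_bezout_degree_bounds[OF nz] unfolding deg by metis
  obtain c G where G: "g = smult c (?f G)" "content G = 1"
    by (rule content_decompose_fract)
  have c0: "c \<noteq> 0" using G g by auto
  have "?f G dvd g" unfolding G(1) by (rule dvd_smult) simp
  then have "?f G dvd ?f P" "?f G dvd ?f Q" using g dvd_trans by blast+
  then have GP: "G dvd P" "G dvd Q" using G(2) by (auto intro: fract_poly_dvdD)
  obtain ca A where A: "a = smult ca (?f A)" by (rule content_decompose_fract)
  obtain cb B where B: "b = smult cb (?f B)" by (rule content_decompose_fract)
  have ex: "\<exists>n d. d \<noteq> 0 \<and> x = to_fract n / to_fract d" for x :: "int fract"
    by (cases x) (metis Fract_conv_to_fract)
  obtain c1 c2 where c: "c2 \<noteq> 0" "c = to_fract c1 / to_fract c2" using ex by blast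
  obtain a1 a2 where a12: "a2 \<noteq> 0" "ca = to_fract a1 / to_fract a2" using ex by blast
  obtain b1 b2 where b12: "b2 \<noteq> 0" "cb = to_fract b1 / to_fract b2" using ex by blast
  \<comment> \<open>All three coefficients are obtained by multiplying with the common denominator
    \<open>a2 * b2 * c2\<close>.\<close>
  define A' where "A' = smult (a1 * b2 * c2) A"
  define B' where "B' = smult (b1 * a2 * c2) B"
  define k where "k = c1 * a2 * b2"
  have "?f (smult k G) = smult (to_fract (a2 * b2 * c2)) (smult c (?f G))"
    using c by (simp add: k_def fract_poly_smult mult_ac)
  also have "\<dots> = smult (to_fract (a2 * b2 * c2)) (a * ?f P + b * ?f Q)"
    using ab G(1) by simp
  also have "\<dots> = ?f (A' * P + B' * Q)"
    using a12 b12 by (simp add: A B A'_def B'_def fract_poly_smult fract_poly_add fract_poly_mult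
        smult_add_right mult_ac)
  finally have "smult k G = A' * P + B' * Q" by (simp only: fract_poly_eq_iff)
  moreover have "k \<noteq> 0" using c0 c a12 b12 by (auto simp: k_def)
  moreover have "degree A' \<le> degree Q" "degree B' \<le> degree P"
  proof -
    have "degree A' \<le> degree a"
      unfolding A'_def A using a12 by (auto simp: deg)
    moreover have "degree B' \<le> degree b"
      unfolding B'_def B using b12 by (auto simp: deg)
    ultimately show "degree A' \<le> degree Q" "degree B' \<le> degree P" using dab by auto
  qed
  ultimately show ?thesis using GP that by blast
qed

section \<open>Good simultaneous approximations produce small polynomial values\<close>

text \<open>Pigeonhole: the (h + 1)^(n + 1) polynomials with coefficients in \<open>{0..h}\<close>
  take values in an interval of length 2Rh, which is cut into cells of length 2R / h^n. Two
  polynomials in the same cell differ by the desired \<open>P\<close>.\<close>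

lemma poly_dirichlet:
  assumes "1 \<le> n"
  shows "\<exists>C>0. \<forall>h :: nat. 1 \<le> h \<longrightarrow> (\<exists>P. P \<noteq> 0 \<and> degree P \<le> n \<and> height P \<le> int h \<and>
    \<bar>ipoly P \<zeta>\<bar> \<le> C / real h ^ n)"
proof -
  define R where "R = (\<Sum>i\<le>n. \<bar>\<zeta>\<bar> ^ i)"
  have R: "R \<ge> 1"
  proof -
    have "(\<Sum>i\<in>{0}. \<bar>\<zeta>\<bar> ^ i) \<le> R" unfolding R_def by (rule sum_mono2) auto
    then show ?thesis by simp
  qed
  have "\<exists>P. P \<noteq> 0 \<and> degree P \<le> n \<and> height P \<le> int h \<and> \<bar>ipoly P \<zeta>\<bar> \<le> 2 * R / real h ^ n"
    if h: "1 \<le> h" for h :: nat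
  proof -
    define F where "F = {..n} \<rightarrow>\<^sub>E {0..int h}"
    define mk where "mk = (\<lambda>f :: nat \<Rightarrow> int. \<Sum>i\<le>n. monom (f i) i)"
    define g where "g = (\<lambda>f. \<lfloor>(ipoly (mk f) \<zeta> + R * h) * (real h ^ n / (2 * R))\<rfloor>)"
    have coeff_mk: "coeff (mk f) i = (if i \<le> n then f i else 0)" for f i
      unfolding mk_def by (simp add: coeff_sum if_distrib cong: if_cong)
    have deg_mk: "degree (mk f) \<le> n" for f
      by (rule degree_le) (simp add: coeff_mk)
    have hp: "0 < real h ^ n / (2 * R)" using h R by simp
    have rng: "g f \<in> {0..int h ^ Suc n}" if f: "f \<in> F" for f
    proof -
      have "height (mk f) \<le> int h"
        using f unfolding F_def by (intro height_le) (auto simp: coeff_mk PiE_iff)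
      then have "real_of_int (height (mk f)) * R \<le> real h * R"
        using R by (intro mult_right_mono) auto
      then have b: "\<bar>ipoly (mk f) \<zeta>\<bar> \<le> R * h"
        using ipoly_abs_le[OF deg_mk, of f \<zeta>] unfolding R_def[symmetric] by (simp add: mult.commute)
      have "0 \<le> (ipoly (mk f) \<zeta> + R * h) * (real h ^ n / (2 * R))"
        using b hp by (intro mult_nonneg_nonneg) auto
      moreover have "(ipoly (mk f) \<zeta> + R * h) * (real h ^ n / (2 * R))
          \<le> (2 * R * h) * (real h ^ n / (2 * R))"
        using b hp by (intro mult_right_mono) auto
      then have "(ipoly (mk f) \<zeta> + R * h) * (real h ^ n / (2 * R)) \<le> real_of_int (int h ^ Suc n)"
        using R by simp
      ultimately show ?thesis unfolding g_def by (auto simp: floor_le_iff le_floor_iff)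
    qed
    have "card (g ` F) \<le> card {0..int h ^ Suc n}"
      using rng by (intro card_mono) auto
    also have "\<dots> = h ^ Suc n + 1" by (simp add: nat_add_distrib nat_mult_distrib nat_power_eq)
    \<comment> \<open>The right endpoint of the interval costs one extra cell; since n is at least
      1, the polynomials still outnumber the cells.\<close>
    also have "\<dots> < (h + 1) ^ Suc n"
    proof -
      have "h ^ n < (h + 1) ^ n" using assms by (intro power_strict_mono) auto
      then have "(h + 1) * (h ^ n + 1) \<le> (h + 1) * (h + 1) ^ n" by (intro mult_left_mono) auto
      then show ?thesis using h by (simp add: algebra_simps)
    qed
    also have "(h + 1) ^ Suc n = card F"
      unfolding F_def by (subst card_PiE) (auto simp: nat_add_distrib)
    finally have "\<not> inj_on g F" by (rule pigeonhole)
    then obtain f f' where f: "f \<in> F" "f' \<in> F" "f \<noteq> f'" "g f = g f'"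
      by (auto simp: inj_on_def)
    define P where "P = mk f - mk f'"
    have "\<exists>i\<le>n. f i \<noteq> f' i" using f unfolding F_def by (metis PiE_ext atMost_iff)
    then have "P \<noteq> 0" unfolding P_def by (metis coeff_mk right_minus_eq)
    moreover have "degree P \<le> n" unfolding P_def using deg_mk by (intro degree_diff_le)
    moreover have "height P \<le> int h"
    proof (rule height_le)
      fix i
      have "i \<le> n \<Longrightarrow> f i \<in> {0..int h} \<and> f' i \<in> {0..int h}" using f unfolding F_def by (auto simp: PiE_iff)
      then show "\<bar>coeff P i\<bar> \<le> int h" unfolding P_def by (auto simp: coeff_mk)
    qed
    moreover have "\<bar>ipoly P \<zeta>\<bar> \<le> 2 * R / real h ^ n"
    proof -
      have "\<bar>(ipoly (mk f) \<zeta> + R * h) * (real h ^ n / (2 * R))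
          - (ipoly (mk f') \<zeta> + R * h) * (real h ^ n / (2 * R))\<bar> < 1"
        using f(4) unfolding g_def by linarith
      also have "(ipoly (mk f) \<zeta> + R * h) * (real h ^ n / (2 * R))
          - (ipoly (mk f') \<zeta> + R * h) * (real h ^ n / (2 * R)) = ipoly P \<zeta> * (real h ^ n / (2 * R))"
        unfolding P_def ipoly_diff by (simp only: left_diff_distrib distrib_right)
      finally have "\<bar>ipoly P \<zeta>\<bar> * (real h ^ n / (2 * R)) < 1" using hp R by (simp add: abs_mult)
      then show ?thesis using h R by (simp add: field_simps)
    qed
    ultimately show ?thesis by blast
  qed
  then show ?thesis using R by (intro exI[of _ "2 * R"]) auto
qed

section \<open>The functional attached to an approximation vector\<close>

text \<open>The linear functional sending T^i to \<open>y i\<close>. Shifting \<open>y\<close> by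
  \<open>j\<close> corresponds to multiplying the polynomial by T^j, so vanishing on T^j P is
  expressed by a shifted vector.\<close>

definition pairing :: "(nat \<Rightarrow> int) \<Rightarrow> int poly \<Rightarrow> int" where
  "pairing y P = (\<Sum>i\<le>degree P. coeff P i * y i)"

lemma pairing_eq: "degree P \<le> n \<Longrightarrow> pairing y P = (\<Sum>i\<le>n. coeff P i * y i)"
  unfolding pairing_def
  by (rule sum.mono_neutral_left) (auto simp: coeff_eq_0 not_le)

lemma pairing_add: "pairing y (P + Q) = pairing y P + pairing y Q"
proof -
  define n where "n = max (degree P) (degree Q)"
  have "degree P \<le> n" "degree Q \<le> n" "degree (P + Q) \<le> n"
    using degree_add_le[of P n Q] by (auto simp: n_def)
  then show ?thesis by (simp add: pairing_eq[of _ n] sum.distrib distrib_right)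
qed

lemma pairing_smult: "pairing y (smult c P) = c * pairing y P"
  using pairing_eq[of "smult c P" "degree P"] by (simp add: pairing_def sum_distrib_left mult_ac)

lemma pairing_pCons_0: "pairing y (pCons 0 P) = pairing (\<lambda>i. y (Suc i)) P"
  unfolding pairing_eq[OF degree_pCons_le] sum.atMost_Suc_shift by (simp add: pairing_def)

text \<open>\<open>A * P\<close> is a combination of the T^j P with \<open>j \<le> degree A\<close>,
  and the hypothesis says that each of these is annihilated. In the induction the tail of
  \<open>A\<close> is paired with the shifted vector.\<close>

lemma pairing_mult_eq_0:
  "(\<And>j. j \<le> degree A \<Longrightarrow> pairing (\<lambda>i. y (i + j)) P = 0) \<Longrightarrow> pairing y (A * P) = 0"
proof (induction A arbitrary: y)
  case 0
  then show ?case by (simp add: pairing_def)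
next
  case (pCons a A)
  have "pairing (\<lambda>i. y (Suc i)) (A * P) = 0"
  proof (cases "A = 0")
    case False
    then show ?thesis using pCons.prems[of "Suc _"] by (intro pCons.IH) auto
  qed (simp add: pairing_def)
  then show ?case using pCons.prems[of 0]
    by (simp add: pairing_add pairing_smult pairing_pCons_0)
qed

text \<open>For \<open>y i\<close> equal to \<zeta>^i x the functional is evaluation at \<zeta>
  times \<open>x\<close>; each of the n + 1 coefficients adds an error of at most
  \<open>height P * \<epsilon>\<close>.\<close>

lemma pairing_approx:
  assumes "degree P \<le> n" and "\<And>i. i \<le> n \<Longrightarrow> \<bar>\<zeta> ^ i * x - real_of_int (y i)\<bar> \<le> \<epsilon>"
  shows "\<bar>x * ipoly P \<zeta> - real_of_int (pairing y P)\<bar> \<le> real (n + 1) * real_of_int (height P) * \<epsilon>"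
proof -
  have "x * ipoly P \<zeta> - real_of_int (pairing y P)
      = (\<Sum>i\<le>n. real_of_int (coeff P i) * (\<zeta> ^ i * x - real_of_int (y i)))"
    unfolding ipoly_eq_sum_coeffs[OF assms(1)] pairing_eq[OF assms(1)]
    by (simp add: sum_distrib_left sum_subtractf right_diff_distrib mult_ac)
  also have "\<bar>\<dots>\<bar> \<le> (\<Sum>i\<le>n. real_of_int (height P) * \<epsilon>)"
  proof (rule order_trans[OF sum_abs sum_mono])
    fix i assume "i \<in> {..n}"
    moreover have "\<bar>real_of_int (coeff P i)\<bar> \<le> real_of_int (height P)"
      using coeff_abs_le_height[of P i] by linarith
    ultimately show "\<bar>real_of_int (coeff P i) * (\<zeta> ^ i * x - real_of_int (y i))\<bar>
        \<le> real_of_int (height P) * \<epsilon>"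
      unfolding abs_mult using assms(2) by (intro mult_mono) auto
  qed
  finally show ?thesis by (simp add: algebra_simps)
qed

lemma eventually_powr_less:
  fixes a c d :: real
  assumes "a < 0" "0 < d"
  shows "\<forall>\<^sub>F X in at_top. c * X powr a < d"
proof -
  have "((\<lambda>X :: real. c * X powr a) \<longlongrightarrow> c * 0) at_top"
    by (intro tendsto_mult tendsto_const tendsto_neg_powr assms filterlim_ident)
  then show ?thesis using assms(2) by (intro order_tendstoD) auto
qed

text \<open>A Dirichlet polynomial of height about X^(1/k) has value O(1/X) at \<zeta>. The integers
  obtained by pairing its multiples with \<open>y\<close> are therefore a main term, made small by
  the choice of \<open>c\<close>, plus an error of order X^(1/k - l), which tends to 0. Being
  smaller than 1 in modulus, they vanish.\<close>

lemma annihilating_poly: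
  fixes \<zeta> l :: real
  assumes "1 \<le> k" "k \<le> N" "1 < l * real k"
  shows "\<exists>C\<ge>1. \<forall>\<^sub>F X in at_top. \<forall>x y. \<bar>x\<bar> \<le> X \<longrightarrow>
    (\<forall>i\<le>N. \<bar>\<zeta> ^ i * x - real_of_int (y i)\<bar> \<le> X powr (- l)) \<longrightarrow>
    (\<exists>P. P \<noteq> 0 \<and> degree P \<le> k \<and> real_of_int (height P) ^ k \<le> C * X \<and>
      (\<forall>j\<le>N - k. pairing (\<lambda>i. y (i + j)) P = 0))"
proof -
  obtain C0 where C0: "C0 > 0" and dir: "\<And>h :: nat. 1 \<le> h \<Longrightarrow> \<exists>P. P \<noteq> 0 \<and> degree P \<le> k \<and>
      height P \<le> int h \<and> \<bar>ipoly P \<zeta>\<bar> \<le> C0 / real h ^ k"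
    using poly_dirichlet[OF assms(1)] by blast
  define Z where "Z = max 1 \<bar>\<zeta>\<bar> ^ N"
  have Z: "Z \<ge> 1" unfolding Z_def by (intro one_le_power) auto
  \<comment> \<open>The factor 4 makes the main term at most 1/4: |x| is at most \<open>X\<close>,
    |\<zeta>^j| at most \<open>Z\<close>, and the value of \<open>P\<close> at most C0 / h^k, hence
    at most C0 / (cX).\<close>
  define c where "c = 4 * C0 * Z"
  have c: "c > 0" using C0 Z by (simp add: c_def)
  define C where "C = max 1 (2 ^ k * c)"
  \<comment> \<open>The error has k + 1 terms, each with a coefficient of size at most 2t, where t =
    (cX)^(1/k).\<close>
  define D where "D = real (k + 1) * (2 * c powr (1 / k))"
  have k: "real k > 0" using assms(1) by simp
  have neg: "1 / real k - l < 0" using assms(3) k by (simp add: field_simps)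
  have "\<forall>\<^sub>F X in at_top. D * X powr (1 / k - l) < 1 / 2"
    by (rule eventually_powr_less[OF neg]) simp
  moreover have "\<forall>\<^sub>F X in at_top. X \<ge> max 1 (1 / c)" by (rule eventually_ge_at_top)
  ultimately have "\<forall>\<^sub>F X in at_top. \<forall>x y. \<bar>x\<bar> \<le> X \<longrightarrow>
    (\<forall>i\<le>N. \<bar>\<zeta> ^ i * x - real_of_int (y i)\<bar> \<le> X powr (- l)) \<longrightarrow>
    (\<exists>P. P \<noteq> 0 \<and> degree P \<le> k \<and> real_of_int (height P) ^ k \<le> C * X \<and>
      (\<forall>j\<le>N - k. pairing (\<lambda>i. y (i + j)) P = 0))"
  proof eventually_elim
    case (elim X)
    show ?case
    proof (intro allI impI)
      fix x :: real and y :: "nat \<Rightarrow> int"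
      assume x: "\<bar>x\<bar> \<le> X" and y: "\<forall>i\<le>N. \<bar>\<zeta> ^ i * x - real_of_int (y i)\<bar> \<le> X powr (- l)"
      have X: "X \<ge> 1" "c * X \<ge> 1" using elim c by (auto simp: field_simps)
      define t where "t = (c * X) powr (1 / k)"
      define h where "h = nat \<lceil>t\<rceil>"
      have t1: "t \<ge> 1" unfolding t_def using X by (intro ge_one_powr_ge_zero) auto
      \<comment> \<open>Rounding up at most doubles \<open>t\<close>, because \<open>t\<close> is at
        least 1; this is why \<open>X\<close> is taken beyond 1 / c.\<close>
      have th: "t \<le> real h" "real h \<le> 2 * t" "1 \<le> h" unfolding h_def using t1 by linarith+
      have tk: "t ^ k = c * X" unfolding t_def using X k
        by (subst powr_realpow[symmetric]) (auto simp: powr_powr)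
      have hk: "c * X \<le> real h ^ k" "real h ^ k \<le> C * X"
      proof -
        show "c * X \<le> real h ^ k" using power_mono[OF th(1), of k] t1 tk by simp
        have "real h ^ k \<le> (2 * t) ^ k" using th by (intro power_mono) auto
        also have "\<dots> = (2 ^ k * c) * X" using tk by (simp add: power_mult_distrib)
        also have "\<dots> \<le> C * X" unfolding C_def using X by (intro mult_right_mono) auto
        finally show "real h ^ k \<le> C * X" .
      qed
      obtain P where P: "P \<noteq> 0" "degree P \<le> k" "height P \<le> int h" "\<bar>ipoly P \<zeta>\<bar> \<le> C0 / real h ^ k"
        using dir[OF th(3)] by blast
      have hP: "0 \<le> real_of_int (height P)" "real_of_int (height P) \<le> real h"
        using height_pos[OF P(1)] P(3) by linarith+
      have "real_of_int (height P) ^ k \<le> C * X"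
        using power_mono[OF hP(2,1), of k] hk by linarith
      moreover have "pairing (\<lambda>i. y (i + j)) P = 0" if j: "j \<le> N - k" for j
      proof -
        have "\<bar>\<zeta> ^ i * (\<zeta> ^ j * x) - real_of_int (y (i + j))\<bar> \<le> X powr (- l)" if "i \<le> k" for i
          using y[rule_format, of "i + j"] that j assms(2) by (simp add: power_add mult.assoc)
        from pairing_approx[OF P(2) this]
        have 1: "\<bar>\<zeta> ^ j * x * ipoly P \<zeta> - real_of_int (pairing (\<lambda>i. y (i + j)) P)\<bar>
          \<le> real (k + 1) * real_of_int (height P) * X powr (- l)" .
        also have "\<dots> \<le> real (k + 1) * (2 * t) * X powr (- l)"
          using hP th by (intro mult_right_mono mult_left_mono) auto
        also have "\<dots> = D * X powr (1 / k - l)"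
          unfolding D_def t_def using X c by (simp add: powr_mult powr_diff powr_minus field_simps)
        also have "\<dots> < 1 / 2" using elim by simp
        finally have 1: "\<bar>\<zeta> ^ j * x * ipoly P \<zeta> - real_of_int (pairing (\<lambda>i. y (i + j)) P)\<bar> < 1 / 2" .
        have "\<bar>\<zeta> ^ j\<bar> \<le> Z"
        proof -
          have "\<bar>\<zeta>\<bar> ^ j \<le> max 1 \<bar>\<zeta>\<bar> ^ j" by (intro power_mono) auto
          also have "\<dots> \<le> Z" unfolding Z_def using j by (intro power_increasing) auto
          finally show ?thesis by (simp add: power_abs)
        qed
        then have "\<bar>\<zeta> ^ j * x * ipoly P \<zeta>\<bar> \<le> Z * X * (C0 / real h ^ k)"
          unfolding abs_mult using x P(4) X Z C0 by (intro mult_mono) auto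
        also have "\<dots> \<le> Z * X * (C0 / (c * X))"
          using hk X Z C0 c th by (intro mult_left_mono divide_left_mono mult_pos_pos) auto
        also have "\<dots> = 1 / 4" using X Z C0 by (simp add: c_def)
        finally have "\<bar>real_of_int (pairing (\<lambda>i. y (i + j)) P)\<bar> < 1" using 1 by linarith
        then show ?thesis by linarith
      qed
      ultimately show "\<exists>P. P \<noteq> 0 \<and> degree P \<le> k \<and> real_of_int (height P) ^ k \<le> C * X \<and>
        (\<forall>j\<le>N - k. pairing (\<lambda>i. y (i + j)) P = 0)"
        using P by blast
    qed
  qed
  moreover have "C \<ge> 1" by (simp add: C_def)
  ultimately show ?thesis by blast
qed

lemma irrational_of_transcendental:
  fixes \<zeta> :: real
  assumes "\<not> algebraic \<zeta>" "x \<noteq> 0"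
  shows "\<zeta> * real_of_int x \<noteq> real_of_int y"
proof
  assume "\<zeta> * real_of_int x = real_of_int y"
  then have "ipoly [:-y, x:] \<zeta> = 0" by (simp add: ipoly_eq_sum_coeffs[of _ 1] mult.commute)
  then show False using ipoly_neq_0[OF assms(1), of "[:-y, x:]"] assms(2) by simp
qed

section \<open>From the exponent to approximations with large denominators\<close>

text \<open>Only finitely many \<open>x\<close> occur, and for each the distance from \<zeta> x to
  the nearest integer is positive. The inserted 1 keeps the minimum defined when no \<open>x\<close>
  qualifies.\<close>

lemma transcendental_multiples_away_from_int:
  fixes \<zeta> :: real and K :: int
  assumes "\<not> algebraic \<zeta>"
  shows "\<exists>\<delta>>0. \<forall>x y :: int. x \<noteq> 0 \<longrightarrow> \<bar>x\<bar> \<le> K \<longrightarrow> \<delta> \<le> \<bar>\<zeta> * real_of_int x - real_of_int y\<bar>"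
proof -
  let ?g = "\<lambda>x :: int. \<bar>\<zeta> * real_of_int x - real_of_int (round (\<zeta> * real_of_int x))\<bar>"
  define A where "A = insert 1 (?g ` ({-K..K} - {0}))"
  have fin: "finite A" "A \<noteq> {}" unfolding A_def by auto
  have "\<forall>a\<in>A. 0 < a" unfolding A_def
    using irrational_of_transcendental[OF assms] by auto
  then have "0 < Min A" using fin by simp
  moreover have "Min A \<le> \<bar>\<zeta> * real_of_int x - real_of_int y\<bar>" if "x \<noteq> 0" "\<bar>x\<bar> \<le> K" for x y :: int
  proof -
    have "?g x \<in> A" unfolding A_def using that by (intro insertI2 imageI) auto
    then have "Min A \<le> ?g x" using fin by simp
    also have "\<dots> \<le> \<bar>\<zeta> * real_of_int x - real_of_int y\<bar>"
      by (rule round_diff_minimal)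
    finally show ?thesis .
  qed
  ultimately show ?thesis by blast
qed

text \<open>Replaces the parameter \<open>X\<close> of the definition by |x| itself, which only
  weakens the bound since l > 0. As \<open>X\<close> grows the error falls below the distance
  available to small \<open>x\<close>, so |x| is unbounded. Setting \<open>y 0\<close> to
  \<open>x\<close> makes the coordinate 0 exact.\<close>

lemma lambda_exp_approximations:
  assumes "\<not> algebraic \<zeta>" "1 \<le> N" "0 \<le> a" "ereal a < lambda_exp N \<zeta>"
  obtains l where "a < l" and "\<And>K :: real. \<exists>(x :: int) (y :: nat \<Rightarrow> int). K \<le> real_of_int \<bar>x\<bar> \<and> y 0 = x \<and>
    (\<forall>i\<le>N. \<bar>\<zeta> ^ i * real_of_int x - real_of_int (y i)\<bar> \<le> real_of_int \<bar>x\<bar> powr (- l))"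
proof -
  obtain l where l: "a < l" and ap: "\<And>X0 :: real. \<exists>X \<ge> X0. \<exists>(x :: int) (y :: nat \<Rightarrow> int).
       1 \<le> \<bar>x\<bar> \<and> real_of_int \<bar>x\<bar> \<le> X \<and>
       Max ((\<lambda>i. \<bar>\<zeta> ^ i * real_of_int x - real_of_int (y i)\<bar>) ` {1..N}) \<le> X powr (- l)"
    using assms(4) unfolding lambda_exp_def less_Sup_iff by auto
  have "\<exists>(x :: int) (y :: nat \<Rightarrow> int). K \<le> real_of_int \<bar>x\<bar> \<and> y 0 = x \<and>
    (\<forall>i\<le>N. \<bar>\<zeta> ^ i * real_of_int x - real_of_int (y i)\<bar> \<le> real_of_int \<bar>x\<bar> powr (- l))" for K :: real
  proof -
    obtain \<delta> where \<delta>: "\<delta> > 0" and away: "\<And>x y :: int. x \<noteq> 0 \<Longrightarrow> \<bar>x\<bar> \<le> \<lceil>K\<rceil> \<Longrightarrow>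
        \<delta> \<le> \<bar>\<zeta> * real_of_int x - real_of_int y\<bar>"
      using transcendental_multiples_away_from_int[OF assms(1)] by blast
    have "\<forall>\<^sub>F X in at_top. 1 * X powr (- l) < \<delta>"
      by (rule eventually_powr_less) (use l assms \<delta> in auto)
    then obtain X0 where X0: "\<And>X. X \<ge> X0 \<Longrightarrow> X powr (- l) < \<delta>"
      by (auto simp: eventually_at_top_linorder)
    obtain X x y where X: "X \<ge> X0" and x: "1 \<le> \<bar>x\<bar>" "real_of_int \<bar>x\<bar> \<le> X"
      and y: "Max ((\<lambda>i. \<bar>\<zeta> ^ i * real_of_int x - real_of_int (y i)\<bar>) ` {1..N}) \<le> X powr (- l)"
      using ap by blast
    have y': "\<bar>\<zeta> ^ i * real_of_int x - real_of_int (y i)\<bar> \<le> X powr (- l)" if "i \<in> {1..N}" for i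
      using y that by (subst (asm) Max_le_iff) auto
    have "\<bar>\<zeta> * real_of_int x - real_of_int (y 1)\<bar> < \<delta>"
      using y'[of 1] X0[OF X] assms(2) by auto
    then have "\<not> \<bar>x\<bar> \<le> \<lceil>K\<rceil>" using away[of x "y 1"] x by force
    then have "K \<le> real_of_int \<bar>x\<bar>" by linarith
    moreover have le: "X powr (- l) \<le> real_of_int \<bar>x\<bar> powr (- l)"
      using x l assms(3) by (intro powr_mono2') auto
    have "\<bar>\<zeta> ^ i * real_of_int x - real_of_int ((y(0 := x)) i)\<bar> \<le> real_of_int \<bar>x\<bar> powr (- l)"
      if "i \<le> N" for i
    proof (cases "i = 0")
      case False
      then show ?thesis using order_trans[OF y'[of i] le] that by simp
    qed simp
    ultimately show ?thesis by (intro exI[of _ x] exI[of _ "y(0 := x)"]) auto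
  qed
  then show ?thesis using l that by blast
qed

text \<open>A finite set of positive numbers has a positive minimum. This yields infinitely many
  polynomials from values that are arbitrarily small but never 0.\<close>

lemma infinite_of_small_values:
  fixes f :: "'a \<Rightarrow> real"
  assumes "\<And>\<delta>. 0 < \<delta> \<Longrightarrow> \<exists>a\<in>S. f a < \<delta>" and "\<And>a. a \<in> S \<Longrightarrow> 0 < f a"
  shows "infinite S"
proof
  assume "finite S"
  then have fin: "finite (insert 1 (f ` S))" by simp
  then have "0 < Min (insert 1 (f ` S))" using assms(2) by (subst Min_gr_iff) auto
  then obtain a where a: "a \<in> S" "f a < Min (insert 1 (f ` S))" using assms(1) by blast
  then show False using Min_le[OF fin, of "f a"] by auto
qed

section \<open>Transference (A)\<close>

text \<open>The common divisor \<open>G\<close> inherits its degree from \<open>P\<close> and its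
  height bound from \<open>Q\<close>, where h^n = O(X) with n = N - m. Since \<open>G\<close> is
  annihilated, its value at \<zeta> is at most of order h X^(-l) / X, hence of order X^(-l) / h^(n -
  1).\<close>

lemma lambda_exp_large_imp_w_exp_large:
  assumes "\<not> algebraic \<zeta>" "1 \<le> m" "2 * m \<le> N" "ereal (1 / real m) < lambda_exp N \<zeta>"
  shows "ereal (real (N - m) - 1) \<le> w_exp m \<zeta>"
proof -
  define n where "n = N - m"
  have N: "1 \<le> N" "m \<le> N" "1 \<le> n" "m \<le> n" "n \<le> N" "N - n = m" using assms by (auto simp: n_def)
  obtain l where l: "1 / real m < l"
    and ap: "\<And>K :: real. \<exists>(x :: int) (y :: nat \<Rightarrow> int). K \<le> real_of_int \<bar>x\<bar> \<and> y 0 = x \<and>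
      (\<forall>i\<le>N. \<bar>\<zeta> ^ i * real_of_int x - real_of_int (y i)\<bar> \<le> real_of_int \<bar>x\<bar> powr (- l))"
    using lambda_exp_approximations[OF assms(1) N(1) _ assms(4)] by auto
  have lm: "1 < l * real m" using l assms(2) by (simp add: field_simps)
  have l0: "0 < l" using l assms(2) by (meson less_trans of_nat_0_less_iff zero_less_divide_1_iff less_le_trans zero_less_one)
  \<comment> \<open>From \<open>2 * m \<le> N\<close> one has \<open>m \<le> n\<close>, so
    \<open>annihilating_poly\<close> applies with \<open>k = n\<close> as well as with
    \<open>k = m\<close>.\<close>
  have ln: "1 < l * real n" using lm mult_left_mono[of "real m" "real n" l] l0 N(4) by linarith
  define ann where "ann = (\<lambda>k C X. \<forall>x y. \<bar>x\<bar> \<le> X \<longrightarrow>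
    (\<forall>i\<le>N. \<bar>\<zeta> ^ i * x - real_of_int (y i)\<bar> \<le> X powr (- l)) \<longrightarrow>
    (\<exists>P. P \<noteq> 0 \<and> degree P \<le> k \<and> real_of_int (height P) ^ k \<le> C * X \<and>
      (\<forall>j\<le>N - k. pairing (\<lambda>i. y (i + j)) P = 0)))"
  obtain C1 where ev1: "\<forall>\<^sub>F X in at_top. ann m C1 X"
    using annihilating_poly[OF assms(2) N(2) lm] unfolding ann_def by blast
  obtain C2 where C2: "C2 \<ge> 1" and ev2: "\<forall>\<^sub>F X in at_top. ann n C2 X"
    using annihilating_poly[OF N(3,5) ln] unfolding ann_def by blast
  obtain C3 where C3: "C3 \<ge> 1" and fac: "\<And>G P. P \<noteq> 0 \<Longrightarrow> degree P \<le> n \<Longrightarrow> G dvd P \<Longrightarrow>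
     real_of_int (height G) \<le> C3 * real_of_int (height P)"
    using height_factor_le[of n] by blast
  define E where "E = real (m + 1) * (C3 ^ n * C2)"
  have E: "E > 0" unfolding E_def using C2 C3 by auto
  let ?S = "{P. degree P \<le> m \<and> 0 < \<bar>ipoly P \<zeta>\<bar> \<and>
       \<bar>ipoly P \<zeta>\<bar> \<le> real_of_int (height P) powr (- (real n - 1))}"
  have "\<exists>G\<in>?S. \<bar>ipoly G \<zeta>\<bar> < \<delta>" if \<delta>: "0 < \<delta>" for \<delta>
  proof -
    have "\<forall>\<^sub>F X in at_top. E * X powr (- l) < min 1 \<delta>"
      by (rule eventually_powr_less) (use l0 \<delta> in auto)
    then have "\<forall>\<^sub>F X in at_top. E * X powr (- l) < min 1 \<delta> \<and> 1 \<le> X \<and> ann m C1 X \<and> ann n C2 X"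
      using ev1 ev2 eventually_ge_at_top[of "1 :: real"] by eventually_elim blast
    then obtain K where K: "\<And>X. X \<ge> K \<Longrightarrow> E * X powr (- l) < min 1 \<delta>" "\<And>X. X \<ge> K \<Longrightarrow> 1 \<le> X"
      "\<And>X. X \<ge> K \<Longrightarrow> ann m C1 X" "\<And>X. X \<ge> K \<Longrightarrow> ann n C2 X"
      unfolding eventually_at_top_linorder by blast
    obtain x :: int and y where x: "K \<le> real_of_int \<bar>x\<bar>" "y 0 = x" and
      y: "\<forall>i\<le>N. \<bar>\<zeta> ^ i * real_of_int x - real_of_int (y i)\<bar> \<le> real_of_int \<bar>x\<bar> powr (- l)"
      using ap by blast
    define X where "X = real_of_int \<bar>x\<bar>"
    note y = y[folded X_def]
    have XK: "X \<ge> K" and xX: "\<bar>real_of_int x\<bar> = X" using x by (auto simp: X_def)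
    obtain P where P: "P \<noteq> 0" "degree P \<le> m" "\<forall>j\<le>N - m. pairing (\<lambda>i. y (i + j)) P = 0"
      using K(3)[OF XK, unfolded ann_def, rule_format, OF _ y[rule_format]] xX by auto
    obtain Q where Q: "Q \<noteq> 0" "degree Q \<le> n" "real_of_int (height Q) ^ n \<le> C2 * X"
       "\<forall>j\<le>N - n. pairing (\<lambda>i. y (i + j)) Q = 0"
      using K(4)[OF XK, unfolded ann_def, rule_format, OF _ y[rule_format]] xX by auto
    obtain G A B k where G: "G dvd P" "G dvd Q" "k \<noteq> 0" "smult k G = A * P + B * Q"
      "degree A \<le> degree Q" "degree B \<le> degree P"
      using int_poly_bezout_degree_bounds[OF P(1) Q(1)] .
    have G0: "G \<noteq> 0" using G(1) P(1) by auto
    have dG: "degree G \<le> m" using dvd_imp_degree_le[OF G(1) P(1)] P(2) by simp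
    \<comment> \<open>The degrees match exactly: \<open>A\<close> has degree at most n = N - m and
      \<open>B\<close> at most m = N - n, the ranges of shifts on which \<open>P\<close> and
      \<open>Q\<close> are annihilated.\<close>
    have "pairing y (A * P) = 0" by (rule pairing_mult_eq_0) (use P(3) G(5) Q(2) n_def in auto)
    moreover have "pairing y (B * Q) = 0" by (rule pairing_mult_eq_0) (use Q(4) G(6) P(2) N in auto)
    ultimately have "k * pairing y G = 0" by (simp add: pairing_add G(4) flip: pairing_smult)
    then have "pairing y G = 0" using G(3) by simp
    moreover have "\<bar>real_of_int x * ipoly G \<zeta> - real_of_int (pairing y G)\<bar>
        \<le> real (m + 1) * real_of_int (height G) * X powr (- l)"
      by (rule pairing_approx[OF dG]) (use y N in auto)
    ultimately have sm: "X * \<bar>ipoly G \<zeta>\<bar> \<le> real (m + 1) * real_of_int (height G) * X powr (- l)"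
      using xX by (simp add: abs_mult)
    define h where "h = real_of_int (height G)"
    have h1: "h \<ge> 1" unfolding h_def using height_pos[OF G0] by simp
    have X1: "X \<ge> 1" using K(2)[OF XK] .
    have "h \<le> C3 * real_of_int (height Q)" unfolding h_def using fac Q(1,2) G(2) by blast
    then have "h ^ n \<le> (C3 * real_of_int (height Q)) ^ n" using h1 by (intro power_mono) auto
    also have "\<dots> \<le> C3 ^ n * (C2 * X)" unfolding power_mult_distrib using Q(3) C3
      by (intro mult_left_mono) auto
    finally have hn: "h ^ n \<le> C3 ^ n * C2 * X" by (simp add: mult.assoc)
    \<comment> \<open>Multiplying by h^(n - 1) completes h to h^n, whose bound O(X) cancels the
      factor \<open>X\<close> on the left.\<close>
    have "X * (\<bar>ipoly G \<zeta>\<bar> * h ^ (n - 1)) \<le> real (m + 1) * h * X powr (- l) * h ^ (n - 1)"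
      using mult_right_mono[OF sm, of "h ^ (n - 1)"] h1 by (simp add: h_def mult_ac)
    also have "\<dots> = real (m + 1) * X powr (- l) * h ^ n"
      using N(3) by (simp add: power_eq_if)
    also have "\<dots> \<le> real (m + 1) * X powr (- l) * (C3 ^ n * C2 * X)"
      using hn by (intro mult_left_mono) auto
    also have "\<dots> = X * (E * X powr (- l))" by (simp add: E_def)
    finally have "\<bar>ipoly G \<zeta>\<bar> * h ^ (n - 1) \<le> E * X powr (- l)"
      using X1 by (subst (asm) mult_le_cancel_left_pos) auto
    also have "\<dots> < min 1 \<delta>" using K(1)[OF XK] .
    finally have fin: "\<bar>ipoly G \<zeta>\<bar> * h ^ (n - 1) < min 1 \<delta>" .
    have "h ^ (n - 1) \<ge> 1" using h1 by (rule one_le_power)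
    then have "\<bar>ipoly G \<zeta>\<bar> * 1 \<le> \<bar>ipoly G \<zeta>\<bar> * h ^ (n - 1)" by (intro mult_left_mono) auto
    then have "\<bar>ipoly G \<zeta>\<bar> < \<delta>" using fin by simp
    moreover have "\<bar>ipoly G \<zeta>\<bar> \<le> h powr (- (real n - 1))"
    proof -
      have "h powr (real n - 1) = h ^ (n - 1)" using h1 N(3) by (simp flip: powr_realpow add: of_nat_diff)
      then have "\<bar>ipoly G \<zeta>\<bar> * h powr (real n - 1) \<le> 1" using fin by simp
      then show ?thesis using h1 by (simp only: powr_minus) (simp add: field_simps)
    qed
    moreover have "0 < \<bar>ipoly G \<zeta>\<bar>" using ipoly_neq_0[OF assms(1) G0] by simp
    ultimately show ?thesis using dG unfolding h_def by blast
  qed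
  then have "infinite ?S" by (rule infinite_of_small_values) auto
  then show ?thesis unfolding w_exp_def n_def[symmetric] by (intro Sup_upper) blast
qed

section \<open>Small polynomial values produce good simultaneous approximations\<close>

lemma ipoly_pCons: "ipoly (pCons a P) x = real_of_int a + x * ipoly P x"
  by (simp add: map_poly_pCons)

lemma ipoly_add: "ipoly (P + Q) x = ipoly P x + ipoly Q x"
  using ipoly_diff[of "P + Q" Q x] by simp

lemma ipoly_smult: "ipoly (smult c P) x = real_of_int c * ipoly P x"
  by (simp add: map_poly_smult)

lemma ipoly_translate: "ipoly (pcompose P [:b, 1:]) x = ipoly P (x + real_of_int b)"
  by (induction P) (simp_all add: pcompose_pCons ipoly_pCons ipoly_add ipoly_smult algebra_simps)

section \<open>Integer vectors satisfying a recurrence\<close>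

text \<open>Entry \<open>j\<close> occurs only in the term k = 0, with coefficient
  \<open>c 0\<close>, so division with remainder adjusts the sum. The sign in \<open>v\<close>
  appears because the division is by the absolute value.\<close>

lemma exists_bounded_remainder:
  fixes c a :: "nat \<Rightarrow> int"
  assumes "c 0 \<noteq> 0"
  shows "\<exists>v. (\<Sum>k\<le>m. c k * (a(j := v)) (j + k)) \<in> {0..<\<bar>c 0\<bar>}"
proof -
  define S where "S = (\<Sum>k=1..m. c k * a (j + k))"
  define v where "v = - sgn (c 0) * (S div \<bar>c 0\<bar>)"
  have "{..m} = insert 0 {1..m}" by auto
  then have "(\<Sum>k\<le>m. c k * (a(j := v)) (j + k)) = c 0 * v + S" by (simp add: S_def)
  also have "c 0 * v = - (\<bar>c 0\<bar> * (S div \<bar>c 0\<bar>))" by (simp add: v_def abs_sgn)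
  also have "- (\<bar>c 0\<bar> * (S div \<bar>c 0\<bar>)) + S = S mod \<bar>c 0\<bar>" by (simp add: minus_mult_div_eq_mod[symmetric])
  also have "\<dots> \<in> {0..<\<bar>c 0\<bar>}" using assms by simp
  finally show ?thesis by blast
qed

text \<open>The entries n, n - 1, ..., 0 are chosen in this order. The sum at \<open>j\<close>
  involves only entries from \<open>j\<close> upwards, so later choices do not disturb it.\<close>

lemma exists_downward_extension:
  fixes c a :: "nat \<Rightarrow> int"
  assumes "c 0 \<noteq> 0"
  shows "\<exists>z. (\<forall>i>n. z i = a i) \<and> (\<forall>j\<le>n. (\<Sum>k\<le>m. c k * z (j + k)) \<in> {0..<\<bar>c 0\<bar>})"
proof (induction n arbitrary: a)
  case 0
  obtain v where "(\<Sum>k\<le>m. c k * (a(0 := v)) (0 + k)) \<in> {0..<\<bar>c 0\<bar>}"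
    using exists_bounded_remainder[where c = c, OF assms] by blast
  then show ?case by (intro exI[of _ "a(0 := v)"]) auto
next
  case (Suc n)
  obtain v where v: "(\<Sum>k\<le>m. c k * (a(Suc n := v)) (Suc n + k)) \<in> {0..<\<bar>c 0\<bar>}"
    using exists_bounded_remainder[where c = c, OF assms] by blast
  obtain z where z: "\<And>i. i > n \<Longrightarrow> z i = (a(Suc n := v)) i"
    "\<And>j. j \<le> n \<Longrightarrow> (\<Sum>k\<le>m. c k * z (j + k)) \<in> {0..<\<bar>c 0\<bar>}"
    using Suc[of "a(Suc n := v)"] by blast
  have "(\<Sum>k\<le>m. c k * z (Suc n + k)) = (\<Sum>k\<le>m. c k * (a(Suc n := v)) (Suc n + k))"
    using z(1) by (intro sum.cong) auto
  then have "(\<Sum>k\<le>m. c k * z (j + k)) \<in> {0..<\<bar>c 0\<bar>}" if "j \<le> Suc n" for j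
    using v z(2) that by (cases "j = Suc n") auto
  moreover have "z i = a i" if "i > Suc n" for i using z(1)[of i] that by simp
  ultimately show ?case by blast
qed

text \<open>In place of Minkowski's theorem on linear forms: for \<open>0 \<le> q \<le> Q\<close> complete \<open>q\<close> downwards to a vector
  with \<open>z N = q\<close> that satisfies the recurrence up to remainders below \<open>\<bar>c 0\<bar>\<close>. There are fewer
  patterns of remainders and (discretised) fractional parts than values of \<open>q\<close>, and the difference
  of two vectors with the same pattern satisfies the recurrence exactly.\<close>

lemma exists_recurrent_approximation:
  fixes c :: "nat \<Rightarrow> int" and \<theta> :: "nat \<Rightarrow> real"
  assumes "c 0 \<noteq> 0" "1 \<le> m" "m \<le> N" "1 \<le> D"
  shows "\<exists>z :: nat \<Rightarrow> int. z N \<noteq> 0 \<and> \<bar>z N\<bar> \<le> \<bar>c 0\<bar> ^ (N - m + 1) * int D ^ (m - 1) \<and>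
    (\<forall>j\<le>N - m. (\<Sum>k\<le>m. c k * z (j + k)) = 0) \<and>
    (\<forall>i. N - m < i \<longrightarrow> i < N \<longrightarrow> \<bar>real_of_int (z i) - \<theta> i * real_of_int (z N)\<bar> \<le> 1 / real D)"
proof -
  define n where "n = N - m"
  \<comment> \<open>\<open>Q\<close> counts the patterns: n + 1 remainders below |c 0|, and one of
    \<open>D\<close> cells for each of the m - 1 fractional parts. The parameter \<open>q\<close>
    runs through Q + 1 values.\<close>
  define Q where "Q = nat \<bar>c 0\<bar> ^ (n + 1) * D ^ (m - 1)"
  have "\<forall>q :: nat. \<exists>z. (\<forall>i>n. z i = (if i = N then int q else \<lfloor>\<theta> i * real q\<rfloor>)) \<and>
      (\<forall>j\<le>n. (\<Sum>k\<le>m. c k * z (j + k)) \<in> {0..<\<bar>c 0\<bar>})"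
    by (intro allI exists_downward_extension assms(1))
  then obtain z :: "nat \<Rightarrow> nat \<Rightarrow> int" where
    z1: "\<And>q i. i > n \<Longrightarrow> z q i = (if i = N then int q else \<lfloor>\<theta> i * real q\<rfloor>)" and
    z2: "\<And>q j. j \<le> n \<Longrightarrow> (\<Sum>k\<le>m. c k * z q (j + k)) \<in> {0..<\<bar>c 0\<bar>}" by metis
  define r where "r = (\<lambda>q. \<lambda>j\<in>{..n}. \<Sum>k\<le>m. c k * z q (j + k))"
  define f where "f = (\<lambda>q. \<lambda>i\<in>{n<..<N}. \<lfloor>real D * frac (\<theta> i * real q)\<rfloor>)"
  define T where "T = ({..n} \<rightarrow>\<^sub>E {0..<\<bar>c 0\<bar>}) \<times> ({n<..<N} \<rightarrow>\<^sub>E {0..<int D})"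
  have rT: "(r q, f q) \<in> T" for q
  proof -
    have "\<lfloor>real D * frac (\<theta> i * real q)\<rfloor> \<in> {0..<int D}" for i
    proof -
      have "real D * frac (\<theta> i * real q) < real D * 1"
        using assms(4) frac_lt_1 by (intro mult_strict_left_mono) auto
      then show ?thesis by (auto simp: floor_less_iff)
    qed
    then show ?thesis using z2 unfolding T_def r_def f_def by (auto intro!: restrict_PiE_iff[THEN iffD2])
  qed
  have finT: "finite T" unfolding T_def by (intro finite_cartesian_product finite_PiE) auto
  have "card T = Q"
  proof -
    have "N - Suc n = m - 1" using assms by (simp add: n_def)
    then show ?thesis unfolding T_def Q_def by (simp add: card_cartesian_product card_PiE)
  qed
  moreover have "card ((\<lambda>q. (r q, f q)) ` {..Q}) \<le> card T"
    using rT finT by (intro card_mono) auto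
  ultimately have "card ((\<lambda>q. (r q, f q)) ` {..Q}) < card {..Q}" by simp
  then have "\<not> inj_on (\<lambda>q. (r q, f q)) {..Q}" by (rule pigeonhole)
  then obtain q q' where q: "q \<le> Q" "q' \<le> Q" "q \<noteq> q'" "r q = r q'" "f q = f q'"
    by (auto simp: inj_on_def)
  define w where "w = (\<lambda>i. z q i - z q' i)"
  have nN: "n < N" using assms by (simp add: n_def)
  have wN: "w N = int q - int q'" unfolding w_def using z1[of N] nN by simp
  show ?thesis
  proof (intro exI[of _ w] conjI allI impI)
    show "w N \<noteq> 0" using wN q by simp
    have "\<bar>w N\<bar> \<le> int Q" unfolding wN using q by linarith
    then show "\<bar>w N\<bar> \<le> \<bar>c 0\<bar> ^ (N - m + 1) * int D ^ (m - 1)"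
      unfolding Q_def n_def by simp
    show "(\<Sum>k\<le>m. c k * w (j + k)) = 0" if "j \<le> N - m" for j
    proof -
      have "(\<Sum>k\<le>m. c k * w (j + k)) = r q j - r q' j"
        unfolding w_def r_def using that by (simp add: n_def right_diff_distrib sum_subtractf)
      then show ?thesis using q by simp
    qed
    show "\<bar>real_of_int (w i) - \<theta> i * real_of_int (w N)\<bar> \<le> 1 / real D" if "N - m < i" "i < N" for i
    proof -
      have i: "n < i" "i \<noteq> N" using that by (auto simp: n_def)
      have "f q i = f q' i" using q by simp
      then have "\<bar>real D * frac (\<theta> i * real q) - real D * frac (\<theta> i * real q')\<bar> < 1"
        unfolding f_def using that by (simp add: n_def) linarith
      then have "real D * \<bar>frac (\<theta> i * real q) - frac (\<theta> i * real q')\<bar> < 1"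
        by (simp add: abs_mult flip: right_diff_distrib)
      \<comment> \<open>With integer parts as entries, the approximation error is a difference of
        two fractional parts lying in the same cell of width 1 / D.\<close>
      moreover have "w i = \<lfloor>\<theta> i * real q\<rfloor> - \<lfloor>\<theta> i * real q'\<rfloor>"
        unfolding w_def using z1[OF i(1)] i(2) by simp
      then have "real_of_int (w i) - \<theta> i * real_of_int (w N)
          = - (frac (\<theta> i * real q) - frac (\<theta> i * real q'))"
        unfolding wN by (simp add: frac_def algebra_simps)
      ultimately have "real D * \<bar>real_of_int (w i) - \<theta> i * real_of_int (w N)\<bar> < 1"
        by (simp only: abs_minus_cancel)
      then show ?thesis using assms(4) by (simp add: field_simps)
    qed
  qed
qed

text \<open>A discrete Gronwall argument downwards: each step is controlled by at most m earlier
  bounds times \<open>B\<close> plus \<open>W\<close>, so it costs a factor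
  \<open>m * B + 1\<close>.\<close>

lemma downward_recurrence_bound:
  fixes e :: "nat \<Rightarrow> real"
  assumes "0 \<le> B" "0 \<le> W"
    and top: "\<And>i. n < i \<Longrightarrow> i \<le> n + m \<Longrightarrow> \<bar>e i\<bar> \<le> W"
    and rec: "\<And>j. j \<le> n \<Longrightarrow> \<bar>e j\<bar> \<le> B * (\<Sum>k=1..m. \<bar>e (j + k)\<bar>) + W"
  shows "i \<le> n + m \<Longrightarrow> \<bar>e i\<bar> \<le> (real m * B + 1) ^ (n + m - i) * W"
proof (induction "n + m - i" arbitrary: i rule: less_induct)
  case less
  define A where "A = real m * B + 1"
  have A: "A \<ge> 1" using assms(1) by (simp add: A_def)
  show ?case
  proof (cases "n < i")
    case True
    have "1 * W \<le> A ^ (n + m - i) * W" using A assms(2) by (intro mult_right_mono one_le_power)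
    then show ?thesis using top[OF True less.prems] by (simp add: A_def)
  next
    case False
    show ?thesis
    proof (cases "m = 0")
      case True
      then show ?thesis using rec[of i] False by simp
    next
      case m: False
      define d where "d = n + m - i - 1"
      have d: "n + m - i = Suc d" using m False by (simp add: d_def)
      have "\<bar>e (i + k)\<bar> \<le> A ^ d * W" if k: "k \<in> {1..m}" for k
      proof -
        have "\<bar>e (i + k)\<bar> \<le> A ^ (n + m - (i + k)) * W"
          unfolding A_def using k False by (intro less.hyps) auto
        also have "\<dots> \<le> A ^ d * W"
          using A assms(2) k by (intro mult_right_mono power_increasing) (auto simp: d_def)
        finally show ?thesis .
      qed
      then have "(\<Sum>k=1..m. \<bar>e (i + k)\<bar>) \<le> real (card {1..m}) * (A ^ d * W)"
        by (intro sum_bounded_above) auto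
      then have "B * (\<Sum>k=1..m. \<bar>e (i + k)\<bar>) \<le> B * (real m * (A ^ d * W))"
        using assms(1) by (intro mult_left_mono) auto
      moreover have "1 * W \<le> A ^ d * W" using A assms(2) by (intro mult_right_mono one_le_power)
      ultimately have "\<bar>e i\<bar> \<le> B * (real m * (A ^ d * W)) + A ^ d * W"
        using rec[of i] False by simp
      also have "\<dots> = A ^ Suc d * W" by (simp add: A_def algebra_simps)
      finally show ?thesis unfolding d A_def .
    qed
  qed
qed

section \<open>Change of origin\<close>

text \<open>The values of the translate at 0, ..., m are values of \<open>P\<close> at points of
  \<open>{0..2m}\<close>, so they are bounded in terms of \<open>height P\<close>; interpolation
  recovers the coefficients.\<close>

lemma height_translate_le:
  "\<exists>C\<ge>1. \<forall>P b. degree P \<le> m \<longrightarrow> b \<in> {0..int m} \<longrightarrow>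
     real_of_int (height (pcompose P [:b, 1:])) \<le> C * real_of_int (height P)"
proof -
  obtain C where C1: "C \<ge> 1" and C: "\<And>P B M. degree P \<le> m \<Longrightarrow> B \<subseteq> {0..int m} \<Longrightarrow>
      card B = Suc m \<Longrightarrow> (\<forall>b\<in>B. real_of_int \<bar>poly P b\<bar> \<le> M) \<Longrightarrow>
      real_of_int (height P) \<le> C * M"
    using height_bound_of_values[of "int m" m] by force
  define E where "E = (\<Sum>i\<le>m. (2 * real m) ^ i)"
  have E: "E \<ge> 1"
  proof -
    have "(\<Sum>i\<in>{0}. (2 * real m) ^ i) \<le> E" unfolding E_def by (rule sum_mono2) auto
    then show ?thesis by simp
  qed
  have "real_of_int (height (pcompose P [:b, 1:])) \<le> (C * E) * real_of_int (height P)"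
    if P: "degree P \<le> m" "b \<in> {0..int m}" for P b
  proof -
    have h0: "0 \<le> real_of_int (height P)" using coeff_abs_le_height[of P 0] by linarith
    have "\<forall>t\<in>{0..int m}. real_of_int \<bar>poly (pcompose P [:b, 1:]) t\<bar> \<le> real_of_int (height P) * E"
    proof
      fix t assume t: "t \<in> {0..int m}"
      have "real_of_int \<bar>poly (pcompose P [:b, 1:]) t\<bar> = \<bar>ipoly P (real_of_int (b + t))\<bar>"
        unfolding ipoly_of_int by (simp add: poly_pcompose)
      also have "\<dots> \<le> real_of_int (height P) * (\<Sum>i\<le>m. \<bar>real_of_int (b + t)\<bar> ^ i)"
        by (rule ipoly_abs_le[OF P(1)])
      also have "\<dots> \<le> real_of_int (height P) * E" unfolding E_def
        using t P(2) h0 by (intro mult_left_mono sum_mono power_mono) auto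
      finally show "real_of_int \<bar>poly (pcompose P [:b, 1:]) t\<bar> \<le> real_of_int (height P) * E" .
    qed
    moreover have "degree (pcompose P [:b, 1:]) \<le> m" using P by (simp add: degree_pcompose)
    ultimately have "real_of_int (height (pcompose P [:b, 1:])) \<le> C * (real_of_int (height P) * E)"
      by (intro C[of _ "{0..int m}"]) auto
    then show ?thesis by (simp add: mult_ac)
  qed
  moreover have "C * E \<ge> 1" using C1 E mult_mono[of 1 C 1 E] by simp
  ultimately show ?thesis by blast
qed

text \<open>The interpolation bound, applied with \<open>M\<close> the largest modulus of a value at
  the nodes 0, ..., m.\<close>

lemma exists_large_value:
  "\<exists>C\<ge>1. \<forall>P. degree P \<le> m \<longrightarrow>
     (\<exists>b\<in>{0..int m}. real_of_int (height P) \<le> C * real_of_int \<bar>poly P b\<bar>)"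
proof -
  obtain C where C1: "C \<ge> 1" and C: "\<And>P B M. degree P \<le> m \<Longrightarrow> B \<subseteq> {0..int m} \<Longrightarrow>
      card B = Suc m \<Longrightarrow> (\<forall>b\<in>B. real_of_int \<bar>poly P b\<bar> \<le> M) \<Longrightarrow>
      real_of_int (height P) \<le> C * M"
    using height_bound_of_values[of "int m" m] by force
  have "\<exists>b\<in>{0..int m}. real_of_int (height P) \<le> C * real_of_int \<bar>poly P b\<bar>"
    if P: "degree P \<le> m" for P
  proof -
    let ?V = "(\<lambda>b. \<bar>poly P b\<bar>) ` {0..int m}"
    have "Max ?V \<in> ?V" by (intro Max_in) auto
    then obtain b where b: "b \<in> {0..int m}" "Max ?V = \<bar>poly P b\<bar>" by (elim imageE)
    have "\<bar>poly P t\<bar> \<le> \<bar>poly P b\<bar>" if "t \<in> {0..int m}" for t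
      unfolding b(2)[symmetric] using that by (intro Max_ge) auto
    then have "\<forall>t\<in>{0..int m}. real_of_int \<bar>poly P t\<bar> \<le> real_of_int \<bar>poly P b\<bar>"
      by (simp only: of_int_le_iff) simp
    then have "real_of_int (height P) \<le> C * real_of_int \<bar>poly P b\<bar>"
      using P by (intro C[of _ "{0..int m}"]) auto
    then show ?thesis using b(1) by blast
  qed
  then show ?thesis using C1 by blast
qed

text \<open>Expanding (\<eta> + b)^i binomially, the same integral combination of the
  \<open>z k\<close> approximates it; the weights sum to at most (1 + m)^i.\<close>

lemma translate_approximation:
  fixes z :: "nat \<Rightarrow> int" and b :: int and \<eta> :: real
  assumes "\<And>k. k \<le> N \<Longrightarrow> \<bar>\<eta> ^ k * real_of_int (z 0) - real_of_int (z k)\<bar> \<le> W"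
    and "\<bar>b\<bar> \<le> int m" "i \<le> N" "0 \<le> W"
  shows "\<bar>(\<eta> + real_of_int b) ^ i * real_of_int (z 0)
      - real_of_int (\<Sum>k\<le>i. int (i choose k) * b ^ (i - k) * z k)\<bar> \<le> (real m + 1) ^ N * W"
proof -
  have "(\<eta> + real_of_int b) ^ i * real_of_int (z 0)
      - real_of_int (\<Sum>k\<le>i. int (i choose k) * b ^ (i - k) * z k)
      = (\<Sum>k\<le>i. real (i choose k) * real_of_int b ^ (i - k)
          * (\<eta> ^ k * real_of_int (z 0) - real_of_int (z k)))"
    unfolding binomial_ring
    by (simp add: sum_distrib_left sum_distrib_right sum_subtractf right_diff_distrib mult_ac)
  also have "\<bar>\<dots>\<bar> \<le> (\<Sum>k\<le>i. real (i choose k) * real m ^ (i - k) * W)"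
  proof (rule order_trans[OF sum_abs sum_mono])
    fix k assume "k \<in> {..i}"
    then have "\<bar>\<eta> ^ k * real_of_int (z 0) - real_of_int (z k)\<bar> \<le> W" using assms by auto
    moreover have "\<bar>real_of_int b\<bar> ^ (i - k) \<le> real m ^ (i - k)"
      using assms(2) by (intro power_mono) linarith+
    ultimately show "\<bar>real (i choose k) * real_of_int b ^ (i - k)
          * (\<eta> ^ k * real_of_int (z 0) - real_of_int (z k))\<bar> \<le> real (i choose k) * real m ^ (i - k) * W"
      unfolding abs_mult power_abs by (intro mult_mono) auto
  qed
  also have "\<dots> = (1 + real m) ^ i * W"
    unfolding binomial_ring by (simp add: sum_distrib_right)
  also have "\<dots> \<le> (real m + 1) ^ N * W"
    using assms by (intro mult_right_mono) (auto simp: add.commute intro: power_increasing)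
  finally show ?thesis .
qed

text \<open>Translating \<open>P\<close> to a point \<open>b\<close> where \<open>\<bar>P(b)\<bar>\<close> is comparable to the height makes the constant coefficient
  dominant up to a factor, so that solving the recurrence downwards loses only a constant.\<close>

lemma simultaneous_approx_of_poly:
  fixes \<zeta> :: real
  assumes "\<not> algebraic \<zeta>" "1 \<le> m" "m \<le> N"
  shows "\<exists>C\<ge>1. \<forall>P. P \<noteq> 0 \<longrightarrow> degree P \<le> m \<longrightarrow>
    \<bar>ipoly P \<zeta>\<bar> * real_of_int (height P) ^ (N - m + 1 + m * s) \<le> 1 \<longrightarrow>
    (\<exists>y :: nat \<Rightarrow> int.
      (\<forall>i\<le>N. \<bar>\<zeta> ^ i * real_of_int (y 0) - real_of_int (y i)\<bar> \<le> C / real_of_int (height P) ^ s) \<and>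
      real_of_int \<bar>y 0\<bar> \<le> C * real_of_int (height P) ^ (N - m + 1 + s * (m - 1)) \<and>
      (C < real_of_int (height P) ^ s \<longrightarrow> y 0 \<noteq> 0))"
proof -
  define M where "M = N - m + 1"
  define \<kappa> where "\<kappa> = M + s * (m - 1)"
  obtain C1 where C1: "C1 \<ge> 1" and tr: "\<And>P b. degree P \<le> m \<Longrightarrow> b \<in> {0..int m} \<Longrightarrow>
     real_of_int (height (pcompose P [:b, 1:])) \<le> C1 * real_of_int (height P)"
    using height_translate_le[of m] by blast
  obtain C2 where C2: "C2 \<ge> 1" and lv: "\<And>P. degree P \<le> m \<Longrightarrow>
     \<exists>b\<in>{0..int m}. real_of_int (height P) \<le> C2 * real_of_int \<bar>poly P b\<bar>"
    using exists_large_value[of m] by blast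
  define B where "B = C1 * C2"
  have B: "B \<ge> 1" unfolding B_def using C1 C2 mult_mono[of 1 C1 1 C2] by simp
  \<comment> \<open>Bounds |\<eta>| and its inverse for every possible translation \<eta> = \<zeta>
    - b, so that the constants do not depend on the \<open>b\<close> chosen for
    \<open>P\<close>.\<close>
  define Z0 where "Z0 = Max (insert 1 ((\<lambda>b. \<bar>\<zeta> - real_of_int b\<bar>) ` {0..int m}
      \<union> (\<lambda>b. 1 / \<bar>\<zeta> - real_of_int b\<bar>) ` {0..int m}))"
  have Z0: "Z0 \<ge> 1" "\<And>b. b \<in> {0..int m} \<Longrightarrow> \<bar>\<zeta> - real_of_int b\<bar> \<le> Z0"
    "\<And>b. b \<in> {0..int m} \<Longrightarrow> 1 / \<bar>\<zeta> - real_of_int b\<bar> \<le> Z0"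
    unfolding Z0_def by (intro Max_ge; simp)+
  define Z where "Z = Z0 ^ N"
  have Z: "Z \<ge> 1" unfolding Z_def using Z0 by (intro one_le_power)
  define A where "A = (real m * B + 1) ^ N"
  have A: "A \<ge> 1" unfolding A_def using B by (intro one_le_power) auto
  define C4 where "C4 = A * (1 + Z * C1 ^ M)"
  have C1M: "C1 ^ M \<ge> 1" using C1 by (rule one_le_power)
  have C4: "C4 \<ge> 1" unfolding C4_def using A Z C1M mult_mono[of 1 A 1 "1 + Z * C1 ^ M"] by simp
  define C5 where "C5 = (real m + 1) ^ N * ((1 + Z) * C4)"
  define C where "C = max C5 (max (Z * C1 ^ M + C4) (Z * C4))"
  have "1 \<le> Z * C4" using mult_mono[of 1 Z 1 C4] Z C4 by simp
  then have C: "C \<ge> 1" unfolding C_def by simp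
  have "\<exists>y :: nat \<Rightarrow> int.
      (\<forall>i\<le>N. \<bar>\<zeta> ^ i * real_of_int (y 0) - real_of_int (y i)\<bar> \<le> C / real_of_int (height P) ^ s) \<and>
      real_of_int \<bar>y 0\<bar> \<le> C * real_of_int (height P) ^ \<kappa> \<and>
      (C < real_of_int (height P) ^ s \<longrightarrow> y 0 \<noteq> 0)"
    if P: "P \<noteq> 0" "degree P \<le> m" "\<bar>ipoly P \<zeta>\<bar> * real_of_int (height P) ^ (M + m * s) \<le> 1" for P
  proof -
    define h where "h = real_of_int (height P)"
    have h: "h \<ge> 1" unfolding h_def using height_pos[OF P(1)] by simp
    have hs: "h ^ s \<ge> 1" using h by (rule one_le_power)
    obtain b where b: "b \<in> {0..int m}" and hb: "h \<le> C2 * real_of_int \<bar>poly P b\<bar>"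
      using lv[OF P(2)] unfolding h_def by blast
    define R where "R = pcompose P [:b, 1:]"
    define c where "c = coeff R"
    define \<eta> where "\<eta> = \<zeta> - real_of_int b"
    have dR: "degree R \<le> m" unfolding R_def using P(2) by (simp add: degree_pcompose)
    have c0: "c 0 = poly P b" unfolding c_def R_def by (simp flip: poly_0_coeff_0 add: poly_pcompose)
    have c0nz: "c 0 \<noteq> 0" using hb h c0 by auto
    have c01: "1 \<le> real_of_int \<bar>c 0\<bar>" using c0nz by linarith
    have ck: "\<bar>real_of_int (c k)\<bar> \<le> C1 * h" for k
    proof -
      have "\<bar>real_of_int (c k)\<bar> \<le> real_of_int (height R)"
        unfolding c_def using coeff_abs_le_height[of R k] by linarith
      then show ?thesis using tr[OF P(2) b] unfolding R_def h_def by linarith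
    qed
    have cB: "\<bar>real_of_int (c k)\<bar> \<le> B * \<bar>real_of_int (c 0)\<bar>" for k
    proof -
      have "C1 * h \<le> C1 * (C2 * \<bar>real_of_int (c 0)\<bar>)"
        using hb c0 C1 by (intro mult_left_mono) auto
      then show ?thesis using ck[of k] unfolding B_def by (simp add: mult.assoc)
    qed
    have \<eta>0: "\<eta> \<noteq> 0" unfolding \<eta>_def using irrational_of_transcendental[OF assms(1), of 1 b] by simp
    have \<eta>Z: "\<bar>\<eta>\<bar> \<le> Z0" "1 / \<bar>\<eta>\<bar> \<le> Z0" unfolding \<eta>_def using Z0 b by auto
    \<comment> \<open>The vector of powers of \<eta>, normalised to last coordinate 1: \<theta> i is
      \<eta>^i / \<eta>^N.\<close>
    define \<theta> where "\<theta> = (\<lambda>i. 1 / \<eta> ^ (N - i))"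
    have pow_le: "\<bar>t ^ k\<bar> \<le> Z" if "k \<le> N" "\<bar>t\<bar> \<le> Z0" for t k
    proof -
      have "\<bar>t\<bar> ^ k \<le> Z0 ^ k" using that by (intro power_mono) auto
      also have "\<dots> \<le> Z" unfolding Z_def using that Z0 by (intro power_increasing) auto
      finally show ?thesis by (simp add: power_abs)
    qed
    have \<theta>Z: "\<bar>\<theta> i\<bar> \<le> Z" for i
      using pow_le[of "N - i" "1 / \<eta>"] \<eta>Z unfolding \<theta>_def by (simp add: power_one_over)
    have \<theta>shift: "\<theta> (j + k) = \<theta> j * \<eta> ^ k" if "j + k \<le> N" for j k
    proof -
      have "\<eta> ^ (N - j) = \<eta> ^ (N - (j + k)) * \<eta> ^ k" using that by (simp flip: power_add)
      then show ?thesis unfolding \<theta>_def using \<eta>0 by (simp add: field_simps)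
    qed
    define D where "D = nat (height P) ^ s"
    have Dh: "real D = h ^ s" unfolding D_def h_def using height_pos[OF P(1)] by simp
    have D1: "1 \<le> D" using hs Dh by (simp flip: of_nat_le_iff[where 'a = real])
    obtain z where z: "z N \<noteq> 0" "\<bar>z N\<bar> \<le> \<bar>c 0\<bar> ^ (N - m + 1) * int D ^ (m - 1)"
      "\<And>j. j \<le> N - m \<Longrightarrow> (\<Sum>k\<le>m. c k * z (j + k)) = 0"
      "\<And>i. N - m < i \<Longrightarrow> i < N \<Longrightarrow> \<bar>real_of_int (z i) - \<theta> i * real_of_int (z N)\<bar> \<le> 1 / real D"
      using exists_recurrent_approximation[where c = c and \<theta> = \<theta>, OF c0nz assms(2,3) D1] by blast
    have zN: "\<bar>real_of_int (z N)\<bar> \<le> C1 ^ M * h ^ \<kappa>"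
    proof -
      have "real_of_int \<bar>z N\<bar> \<le> real_of_int (\<bar>c 0\<bar> ^ M * int D ^ (m - 1))"
        using z(2) unfolding M_def by (simp only: of_int_le_iff)
      then have "\<bar>real_of_int (z N)\<bar> \<le> \<bar>real_of_int (c 0)\<bar> ^ M * h ^ (s * (m - 1))"
        by (simp add: Dh power_mult)
      also have "\<dots> \<le> (C1 * h) ^ M * h ^ (s * (m - 1))"
        using ck h by (intro mult_right_mono power_mono) auto
      also have "\<dots> = C1 ^ M * h ^ \<kappa>" by (simp add: \<kappa>_def power_add power_mult_distrib)
      finally show ?thesis .
    qed
    define e where "e = (\<lambda>i. real_of_int (z i) - \<theta> i * real_of_int (z N))"
    \<comment> \<open>The two summands cover the grid error 1 / D = 1 / h^s and the defect caused by
      the nonzero value of \<open>P\<close> at \<zeta>.\<close>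
    define W where "W = (1 + Z * C1 ^ M) / h ^ s"
    have W0: "0 \<le> W" unfolding W_def using Z C1M hs by simp
    have W1: "1 / real D \<le> W" unfolding W_def Dh using Z C1M hs
      by (intro divide_right_mono) auto
    have \<rho>: "(\<Sum>k\<le>m. real_of_int (c k) * \<eta> ^ k) = ipoly P \<zeta>"
      using ipoly_eq_sum_coeffs[OF dR, of \<eta>] ipoly_translate[of P b \<eta>]
      by (simp add: R_def c_def \<eta>_def)
    have small: "\<bar>real_of_int (z N)\<bar> * (Z * \<bar>ipoly P \<zeta>\<bar>) \<le> Z * C1 ^ M / h ^ s"
    proof -
      \<comment> \<open>The size h^\<kappa> of \<open>z N\<close> times the assumed bound h^(-(M +
        ms)) leaves exactly h^(-s).\<close>
      have ex: "M + m * s = \<kappa> + s" unfolding \<kappa>_def using assms(2) by (cases m) auto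
      have "\<bar>real_of_int (z N)\<bar> * (Z * \<bar>ipoly P \<zeta>\<bar>) \<le> C1 ^ M * h ^ \<kappa> * (Z * \<bar>ipoly P \<zeta>\<bar>)"
        using zN Z by (intro mult_right_mono) auto
      also have "\<dots> = Z * C1 ^ M * (\<bar>ipoly P \<zeta>\<bar> * h ^ (M + m * s)) / h ^ s"
        unfolding ex power_add using h by simp
      also have "\<dots> \<le> Z * C1 ^ M * 1 / h ^ s"
        using P(3) Z C1M hs unfolding h_def[symmetric] by (intro divide_right_mono mult_left_mono) auto
      finally show ?thesis by simp
    qed
    \<comment> \<open>\<open>z\<close> satisfies the recurrence exactly and \<theta> up to \<theta>
      j times the value of \<open>P\<close> at \<zeta>. Subtracting \<open>z N\<close> times the
      second relation and dividing by \<open>c 0\<close>, against which every coefficient is at most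
      a factor \<open>B\<close>, bounds \<open>e j\<close>.\<close>
    have rec: "\<bar>e j\<bar> \<le> B * (\<Sum>k=1..m. \<bar>e (j + k)\<bar>) + W" if j: "j \<le> N - m" for j
    proof -
      have "(\<Sum>k\<le>m. real_of_int (c k) * e (j + k))
          = real_of_int (\<Sum>k\<le>m. c k * z (j + k))
            - real_of_int (z N) * (\<Sum>k\<le>m. real_of_int (c k) * \<theta> (j + k))"
        unfolding e_def by (simp add: right_diff_distrib sum_subtractf sum_distrib_left mult_ac)
      also have "(\<Sum>k\<le>m. real_of_int (c k) * \<theta> (j + k)) = (\<Sum>k\<le>m. \<theta> j * (real_of_int (c k) * \<eta> ^ k))"
        using j assms(3) by (intro sum.cong) (auto simp: \<theta>shift)
      also have "\<dots> = \<theta> j * ipoly P \<zeta>" by (simp only: \<rho> flip: sum_distrib_left)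
      also have "real_of_int (\<Sum>k\<le>m. c k * z (j + k)) = 0" using z(3)[OF j] by simp
      also have "(\<Sum>k\<le>m. real_of_int (c k) * e (j + k))
          = real_of_int (c 0) * e j + (\<Sum>k=1..m. real_of_int (c k) * e (j + k))"
      proof -
        have "{..m} = insert 0 {1..m}" by auto
        then show ?thesis by simp
      qed
      finally have "real_of_int (c 0) * e j = - (\<Sum>k=1..m. real_of_int (c k) * e (j + k))
          - real_of_int (z N) * (\<theta> j * ipoly P \<zeta>)" by simp
      then have "\<bar>real_of_int (c 0)\<bar> * \<bar>e j\<bar> \<le> \<bar>\<Sum>k=1..m. real_of_int (c k) * e (j + k)\<bar>
          + \<bar>real_of_int (z N) * (\<theta> j * ipoly P \<zeta>)\<bar>"
        unfolding abs_mult[symmetric] by linarith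
      also have "\<bar>\<Sum>k=1..m. real_of_int (c k) * e (j + k)\<bar>
          \<le> (\<Sum>k=1..m. B * \<bar>real_of_int (c 0)\<bar> * \<bar>e (j + k)\<bar>)"
        by (rule order_trans[OF sum_abs sum_mono]) (auto simp: abs_mult intro!: mult_right_mono cB)
      also have "\<dots> = \<bar>real_of_int (c 0)\<bar> * (B * (\<Sum>k=1..m. \<bar>e (j + k)\<bar>))"
        by (simp add: sum_distrib_left mult_ac)
      also have "\<bar>real_of_int (z N) * (\<theta> j * ipoly P \<zeta>)\<bar> \<le> \<bar>real_of_int (z N)\<bar> * (Z * \<bar>ipoly P \<zeta>\<bar>)"
        unfolding abs_mult using \<theta>Z by (intro mult_left_mono mult_right_mono) auto
      also have "\<dots> \<le> Z * C1 ^ M / h ^ s" by (rule small)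
      also have "\<dots> \<le> W" unfolding W_def using hs by (intro divide_right_mono) auto
      also have "W \<le> \<bar>real_of_int (c 0)\<bar> * W" using mult_right_mono[OF c01 W0] by simp
      finally have "\<bar>real_of_int (c 0)\<bar> * \<bar>e j\<bar>
          \<le> \<bar>real_of_int (c 0)\<bar> * (B * (\<Sum>k=1..m. \<bar>e (j + k)\<bar>) + W)"
        by (simp add: distrib_left)
      then show ?thesis using c01 by (subst (asm) mult_le_cancel_left_pos) auto
    qed
    have top: "\<bar>e i\<bar> \<le> W" if "N - m < i" "i \<le> N" for i
    proof (cases "i = N")
      case True
      then show ?thesis using W0 by (simp add: e_def \<theta>_def)
    next
      case False
      then show ?thesis using z(4)[of i] that W1 by (simp add: e_def)
    qed
    have e: "\<bar>e i\<bar> \<le> C4 / h ^ s" if i: "i \<le> N" for i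
    proof -
      have "\<bar>e i\<bar> \<le> (real m * B + 1) ^ (N - m + m - i) * W"
        by (rule downward_recurrence_bound) (use B W0 top rec i assms(3) in auto)
      also have "\<dots> \<le> A * W"
        unfolding A_def using W0 B assms(3) by (intro mult_right_mono power_increasing) auto
      also have "\<dots> = C4 / h ^ s" by (simp add: W_def C4_def)
      finally show ?thesis .
    qed
    have zerr: "\<bar>\<eta> ^ i * real_of_int (z 0) - real_of_int (z i)\<bar> \<le> (1 + Z) * C4 / h ^ s"
      if i: "i \<le> N" for i
    proof -
      \<comment> \<open>Passes from the normalisation by the last coordinate to that by the
        coordinate 0.\<close>
      have "\<eta> ^ i * real_of_int (z 0) - real_of_int (z i) = \<eta> ^ i * e 0 - e i"
        using \<theta>shift[of 0 i] i by (simp add: e_def algebra_simps)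
      moreover have "\<bar>\<eta> ^ i * e 0\<bar> \<le> Z * (C4 / h ^ s)"
        unfolding abs_mult using pow_le[OF i \<eta>Z(1)] e[of 0] Z by (intro mult_mono) auto
      ultimately show ?thesis using e[OF i] by (simp add: distrib_right add_divide_distrib)
    qed
    \<comment> \<open>Undoes the translation by \<open>b\<close>; the coordinate 0 is
      unchanged.\<close>
    define y where "y = (\<lambda>i. \<Sum>k\<le>i. int (i choose k) * b ^ (i - k) * z k)"
    have y0: "y 0 = z 0" by (simp add: y_def)
    have \<zeta>\<eta>: "\<eta> + real_of_int b = \<zeta>" by (simp add: \<eta>_def)
    have "\<bar>\<zeta> ^ i * real_of_int (y 0) - real_of_int (y i)\<bar> \<le> C / h ^ s" if i: "i \<le> N" for i
    proof -
      have "\<bar>(\<eta> + real_of_int b) ^ i * real_of_int (z 0) - real_of_int (y i)\<bar>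
          \<le> (real m + 1) ^ N * ((1 + Z) * C4 / h ^ s)"
        unfolding y_def by (rule translate_approximation) (use zerr b i Z C4 hs in auto)
      also have "\<dots> = C5 / h ^ s" by (simp add: C5_def)
      also have "\<dots> \<le> C / h ^ s" using hs by (intro divide_right_mono) (auto simp: C_def)
      finally show ?thesis unfolding \<zeta>\<eta> y0 .
    qed
    moreover have "real_of_int \<bar>y 0\<bar> \<le> C * h ^ \<kappa>"
    proof -
      have "real_of_int (z 0) = e 0 + \<theta> 0 * real_of_int (z N)" by (simp add: e_def)
      moreover have "\<bar>\<theta> 0 * real_of_int (z N)\<bar> \<le> Z * (C1 ^ M * h ^ \<kappa>)"
        unfolding abs_mult using \<theta>Z zN Z by (intro mult_mono) auto
      moreover have "\<bar>e 0\<bar> \<le> C4 * h ^ \<kappa>"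
      proof -
        have "C4 / h ^ s \<le> C4 / 1" using hs C4 by (intro divide_left_mono) auto
        also have "\<dots> \<le> C4 * h ^ \<kappa>" using one_le_power[OF h, of \<kappa>] C4 by simp
        finally show ?thesis using e[of 0] by simp
      qed
      ultimately have "\<bar>real_of_int (z 0)\<bar> \<le> (Z * C1 ^ M + C4) * h ^ \<kappa>"
        by (simp add: distrib_right mult.assoc)
      also have "\<dots> \<le> C * h ^ \<kappa>" using h by (intro mult_right_mono) (auto simp: C_def)
      finally show ?thesis by (simp add: y0)
    qed
    \<comment> \<open>\<open>z N\<close> is a nonzero integer and |\<theta> 0| is at least 1 / Z, so
      a vanishing \<open>z 0\<close> would leave an error too large for big h^s.\<close>
    moreover have "y 0 \<noteq> 0" if Ch: "C < h ^ s"
    proof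
      assume "y 0 = 0"
      then have "\<bar>\<theta> 0 * real_of_int (z N)\<bar> \<le> C4 / h ^ s" using e[of 0] by (simp add: e_def y0)
      moreover have "1 \<le> \<bar>real_of_int (z N)\<bar>" using z(1) by linarith
      then have "\<bar>\<theta> 0\<bar> * 1 \<le> \<bar>\<theta> 0 * real_of_int (z N)\<bar>" unfolding abs_mult by (intro mult_left_mono) auto
      moreover have "1 / Z \<le> \<bar>\<theta> 0\<bar>"
        using pow_le[of N \<eta>] \<eta>Z \<eta>0 Z by (simp add: \<theta>_def field_simps)
      ultimately have "1 / Z \<le> C4 / h ^ s" by linarith
      then have "h ^ s \<le> Z * C4" using Z hs by (simp add: field_simps)
      also have "\<dots> \<le> C" by (simp add: C_def)
      finally show False using Ch by simp
    qed
    ultimately show ?thesis unfolding h_def by blast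
  qed
  then show ?thesis using C unfolding M_def \<kappa>_def by blast
qed

section \<open>Transference (B)\<close>

text \<open>Polynomials of growing height h give vectors with |y 0| at most X = C h^\<kappa> and
  error at most C / h^s. Hence every exponent below s / \<kappa> is attained, and the supremum is at
  least s / \<kappa>.\<close>

lemma w_exp_large_imp_lambda_exp_large:
  fixes \<zeta> :: real
  assumes "\<not> algebraic \<zeta>" "1 \<le> m" "m \<le> N" "1 \<le> s"
    and "ereal (real (N - m + 1 + m * s)) < w_exp m \<zeta>"
  shows "ereal (real s / real (N - m + 1 + s * (m - 1))) \<le> lambda_exp N \<zeta>"
proof -
  define u where "u = N - m + 1 + m * s"
  define \<kappa> where "\<kappa> = N - m + 1 + s * (m - 1)"
  have \<kappa>: "1 \<le> \<kappa>" by (simp add: \<kappa>_def)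
  obtain C where C: "C \<ge> 1" and ap: "\<And>P. P \<noteq> 0 \<Longrightarrow> degree P \<le> m \<Longrightarrow>
    \<bar>ipoly P \<zeta>\<bar> * real_of_int (height P) ^ u \<le> 1 \<Longrightarrow>
    \<exists>y :: nat \<Rightarrow> int.
      (\<forall>i\<le>N. \<bar>\<zeta> ^ i * real_of_int (y 0) - real_of_int (y i)\<bar> \<le> C / real_of_int (height P) ^ s) \<and>
      real_of_int \<bar>y 0\<bar> \<le> C * real_of_int (height P) ^ \<kappa> \<and>
      (C < real_of_int (height P) ^ s \<longrightarrow> y 0 \<noteq> 0)"
    using simultaneous_approx_of_poly[OF assms(1-3), of s] unfolding u_def \<kappa>_def by blast
  obtain w where w: "real u < w" and inf: "infinite {P :: int poly. degree P \<le> m \<and>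
       0 < \<bar>ipoly P \<zeta>\<bar> \<and> \<bar>ipoly P \<zeta>\<bar> \<le> real_of_int (height P) powr (- w)}" (is "infinite ?S")
    using assms(5) unfolding w_exp_def less_Sup_iff u_def[symmetric] by auto
  \<comment> \<open>Bounded degree and height leave only finitely many polynomials, so infinitely
    many solutions have unbounded height.\<close>
  have large: "\<exists>P\<in>?S. h0 < height P" for h0
  proof (rule ccontr)
    assume "\<not> ?thesis"
    then have "?S \<subseteq> {P. degree P \<le> m \<and> height P \<le> h0}" by auto
    then show False using inf finite_bounded_degree_height finite_subset by blast
  qed
  have "ereal l \<le> lambda_exp N \<zeta>" if l: "l < real s / real \<kappa>" for l
  proof -
    have neg: "real \<kappa> * l - real s < 0" using l \<kappa> by (simp add: field_simps)
    have "\<exists>X \<ge> X0. \<exists>(x :: int) (y :: nat \<Rightarrow> int).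
       1 \<le> \<bar>x\<bar> \<and> real_of_int \<bar>x\<bar> \<le> X \<and>
       Max ((\<lambda>i. \<bar>\<zeta> ^ i * real_of_int x - real_of_int (y i)\<bar>) ` {1..N}) \<le> X powr (- l)" for X0
    proof -
      \<comment> \<open>The left-hand side is (C / h^s) * X^l for X = C h^\<kappa>.\<close>
      have "\<forall>\<^sub>F h in at_top. C * C powr l * h powr (real \<kappa> * l - real s) < 1"
        by (rule eventually_powr_less[OF neg]) simp
      then obtain h0 where h0: "\<And>h. h \<ge> h0 \<Longrightarrow> C * C powr l * h powr (real \<kappa> * l - real s) < 1"
        by (auto simp: eventually_at_top_linorder)
      obtain P where P: "P \<in> ?S" and hP: "\<lceil>max h0 (max X0 (max C 1))\<rceil> < height P" using large by blast
      define h where "h = real_of_int (height P)"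
      have h: "h \<ge> h0" "h \<ge> X0" "h > C" "h \<ge> 1" using hP unfolding h_def by linarith+
      have P0: "P \<noteq> 0" using P by auto
      have "\<bar>ipoly P \<zeta>\<bar> * h ^ u \<le> h powr (- w) * h powr (real u)"
        using P h by (auto simp: h_def powr_realpow intro!: mult_right_mono)
      also have "\<dots> = h powr (real u - w)" by (simp flip: powr_add)
      also have "\<dots> \<le> h powr 0" using w h by (intro powr_mono) auto
      finally have "\<bar>ipoly P \<zeta>\<bar> * h ^ u \<le> 1" using h by simp
      then obtain y :: "nat \<Rightarrow> int" where
        y: "\<forall>i\<le>N. \<bar>\<zeta> ^ i * real_of_int (y 0) - real_of_int (y i)\<bar> \<le> C / h ^ s"
        "real_of_int \<bar>y 0\<bar> \<le> C * h ^ \<kappa>" "C < h ^ s \<longrightarrow> y 0 \<noteq> 0"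
        using ap[OF P0] P unfolding h_def by auto
      define X where "X = C * h ^ \<kappa>"
      have "h ^ 1 \<le> h ^ s" using h assms(4) by (intro power_increasing) auto
      then have "1 \<le> \<bar>y 0\<bar>" using y(3) h by simp
      moreover have "X \<ge> X0"
      proof -
        have "h ^ 1 \<le> h ^ \<kappa>" using h \<kappa> by (intro power_increasing) auto
        also have "1 * h ^ \<kappa> \<le> X" unfolding X_def using C h by (intro mult_right_mono) auto
        then have "h ^ \<kappa> \<le> X" by simp
        finally show ?thesis using h by simp
      qed
      moreover have "C / h ^ s \<le> X powr (- l)"
      proof -
        have "X = C * h powr real \<kappa>" unfolding X_def using h by (simp add: powr_realpow)
        then have "X powr l = C powr l * h powr (real \<kappa> * l)"
          using C h by (simp add: powr_mult powr_powr)
        then have "C * C powr l * h powr (real \<kappa> * l - real s) = (C / h ^ s) * X powr l"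
          using h by (simp add: powr_diff powr_realpow)
        then have "(C / h ^ s) * X powr l \<le> 1" using h0[OF h(1)] by simp
        moreover have "X > 0" unfolding X_def using C h by simp
        ultimately show ?thesis by (simp add: powr_minus field_simps)
      qed
      then have "Max ((\<lambda>i. \<bar>\<zeta> ^ i * real_of_int (y 0) - real_of_int (y i)\<bar>) ` {1..N}) \<le> X powr (- l)"
        using y(1) assms(2,3) by (subst Max_le_iff) (auto intro: order_trans)
      ultimately show ?thesis using y(2) unfolding X_def[symmetric] by blast
    qed
    then show ?thesis unfolding lambda_exp_def by (intro Sup_upper) blast
  qed
  then show ?thesis unfolding \<kappa>_def[symmetric] by (meson ereal_dense2 ereal_less_eq(3) less_ereal.simps(1) not_le)
qed

section \<open>Mahler's classes\<close>

lemma lambda_exp_antimono: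
  assumes "1 \<le> n" "n \<le> n'"
  shows "lambda_exp n' \<zeta> \<le> lambda_exp n \<zeta>"
proof -
  have "Max ((\<lambda>i. \<bar>\<zeta> ^ i * real_of_int x - real_of_int (y i)\<bar>) ` {1..n})
      \<le> Max ((\<lambda>i. \<bar>\<zeta> ^ i * real_of_int x - real_of_int (y i)\<bar>) ` {1..n'})" for x y
    using assms by (intro Max_mono) auto
  then have "\<exists>X \<ge> X0. \<exists>(x :: int) (y :: nat \<Rightarrow> int). 1 \<le> \<bar>x\<bar> \<and> real_of_int \<bar>x\<bar> \<le> X \<and>
       Max ((\<lambda>i. \<bar>\<zeta> ^ i * real_of_int x - real_of_int (y i)\<bar>) ` {1..n}) \<le> X powr (- l)"
    if "\<forall>X0. \<exists>X \<ge> X0. \<exists>(x :: int) (y :: nat \<Rightarrow> int). 1 \<le> \<bar>x\<bar> \<and> real_of_int \<bar>x\<bar> \<le> X \<and>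
       Max ((\<lambda>i. \<bar>\<zeta> ^ i * real_of_int x - real_of_int (y i)\<bar>) ` {1..n'}) \<le> X powr (- l)" for X0 l
    using that by (meson order_trans)
  then show ?thesis
    unfolding lambda_exp_def by (intro Sup_subset_mono Collect_mono) blast
qed

lemma lambda_exp_nonneg:
  assumes "1 \<le> n"
  shows "0 \<le> lambda_exp n \<zeta>"
proof -
  have "\<exists>X \<ge> X0. \<exists>(x :: int) (y :: nat \<Rightarrow> int). 1 \<le> \<bar>x\<bar> \<and> real_of_int \<bar>x\<bar> \<le> X \<and>
       Max ((\<lambda>i. \<bar>\<zeta> ^ i * real_of_int x - real_of_int (y i)\<bar>) ` {1..n}) \<le> X powr (- 0)" for X0
  proof (intro exI[of _ "max 1 X0"] exI[of _ 1] exI[of _ "\<lambda>i. \<lfloor>\<zeta> ^ i\<rfloor>"] conjI)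
    have "\<bar>\<zeta> ^ i - real_of_int \<lfloor>\<zeta> ^ i\<rfloor>\<bar> \<le> 1" for i by linarith
    then show "Max ((\<lambda>i. \<bar>\<zeta> ^ i * real_of_int 1 - real_of_int \<lfloor>\<zeta> ^ i\<rfloor>\<bar>) ` {1..n}) \<le> max 1 X0 powr (- 0)"
      using assms by (subst Max_le_iff) auto
  qed auto
  then have "ereal 0 \<le> lambda_exp n \<zeta>" unfolding lambda_exp_def by (intro Sup_upper) blast
  then show ?thesis by (simp add: zero_ereal_def)
qed

text \<open>Monotonicity is available from index 1 on; at index 0 the maximum is over an empty set.
  Hence the shift by \<open>Suc\<close>.\<close>

lemma lambda_exp_tendsto_lim:
  "(\<lambda>n. lambda_exp n \<zeta>) \<longlonglongrightarrow> lim (\<lambda>n. lambda_exp n \<zeta>)"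
proof -
  have "decseq (\<lambda>n. lambda_exp (Suc n) \<zeta>)"
    by (intro decseq_SucI lambda_exp_antimono) auto
  then have "(\<lambda>n. lambda_exp (Suc n) \<zeta>) \<longlonglongrightarrow> (INF n. lambda_exp (Suc n) \<zeta>)" by (rule LIMSEQ_INF)
  then have "(\<lambda>n. lambda_exp n \<zeta>) \<longlonglongrightarrow> (INF n. lambda_exp (Suc n) \<zeta>)" by (rule LIMSEQ_imp_Suc)
  then show ?thesis by (simp add: limI)
qed

lemma lambda_exp_lim_nonneg: "0 \<le> lim (\<lambda>n. lambda_exp n \<zeta>)"
  by (rule LIMSEQ_le_const[OF lambda_exp_tendsto_lim]) (use lambda_exp_nonneg in blast)

section \<open>U-numbers\<close>

lemma U_number_iff: "U_number \<zeta> \<longleftrightarrow> (\<exists>m\<ge>1. w_exp m \<zeta> = \<infinity>)"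
proof
  assume "\<exists>m\<ge>1. w_exp m \<zeta> = \<infinity>"
  then have ex: "\<exists>m. 1 \<le> m \<and> w_exp m \<zeta> = \<infinity>" by blast
  define m where "m = (LEAST m. 1 \<le> m \<and> w_exp m \<zeta> = \<infinity>)"
  have "1 \<le> m \<and> w_exp m \<zeta> = \<infinity>" unfolding m_def by (rule LeastI_ex[OF ex])
  moreover have "\<not> (1 \<le> k \<and> w_exp k \<zeta> = \<infinity>)" if "k < m" for k
    using that unfolding m_def by (rule not_less_Least)
  ultimately show "U_number \<zeta>" unfolding U_number_def U_index_def by blast
qed (auto simp: U_number_def U_index_def)

text \<open>With \<open>m\<close> fixed, the lower bound N - m - 1 of transference (A) is available
  for arbitrarily large \<open>N\<close>.\<close>

lemma w_exp_infinite_of_frequently_lambda_exp_large: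
  assumes "\<not> algebraic \<zeta>" "1 \<le> m" "\<exists>\<^sub>F n in sequentially. ereal (1 / real m) < lambda_exp n \<zeta>"
  shows "w_exp m \<zeta> = \<infinity>"
proof -
  have "ereal (real k) \<le> w_exp m \<zeta>" for k
  proof -
    obtain N where N: "N \<ge> k + 2 * m + 1" "ereal (1 / real m) < lambda_exp N \<zeta>"
      using assms(3) unfolding frequently_sequentially by blast
    have "ereal (real k) \<le> ereal (real (N - m) - 1)" using N(1) by simp
    also have "\<dots> \<le> w_exp m \<zeta>" using assms N by (intro lambda_exp_large_imp_w_exp_large) auto
    finally show ?thesis .
  qed
  then show ?thesis by (intro ereal_top) (meson order_trans ereal_less_eq(3) real_arch_simple)
qed

text \<open>Transference (B) holds for every \<open>s\<close>, and s / (M + s(m - 1)) tends to 1 /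
  (m - 1) as s grows. For m = 1 it is s / M, which is unbounded, in accordance with 1 / 0 =
  \<infinity>.\<close>

lemma lambda_exp_ge_of_w_exp_infinite:
  assumes "\<not> algebraic \<zeta>" "1 \<le> m" "m \<le> N" "w_exp m \<zeta> = \<infinity>"
  shows "1 / ereal (real m - 1) \<le> lambda_exp N \<zeta>"
proof -
  have lb: "ereal (real s / real (N - m + 1 + s * (m - 1))) \<le> lambda_exp N \<zeta>" if "1 \<le> s" for s
    using assms that by (intro w_exp_large_imp_lambda_exp_large) auto
  define M where "M = N - m + 1"
  have M: "real M > 0" by (simp add: M_def)
  show ?thesis
  proof (cases "m = 1")
    case True
    have "ereal r \<le> lambda_exp N \<zeta>" for r
    proof -
      obtain s where s: "real s \<ge> max 1 (r * real M)" using real_arch_simple by blast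
      have "ereal r \<le> ereal (real s / real M)" using s M by (simp add: field_simps)
      also have "\<dots> \<le> lambda_exp N \<zeta>" using lb[of s] s True by (simp add: M_def)
      finally show ?thesis .
    qed
    then have "lambda_exp N \<zeta> = \<infinity>" by (rule ereal_top)
    then show ?thesis by simp
  next
    case False
    then have m: "real m - 1 > 0" using assms(2) by simp
    have "(\<lambda>s. real s / (real M + real s * (real m - 1))) \<longlonglongrightarrow> 1 / (real m - 1)"
    proof -
      have "(\<lambda>s. 1 / (real M / real s + (real m - 1))) \<longlonglongrightarrow> 1 / (0 + (real m - 1))"
        using m by (intro tendsto_intros lim_const_over_n) auto
      moreover have "\<forall>\<^sub>F s in sequentially. 1 / (real M / real s + (real m - 1))
          = real s / (real M + real s * (real m - 1))"
        using eventually_gt_at_top[of 0] by eventually_elim (simp add: field_simps)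
      ultimately show ?thesis by (simp add: tendsto_cong)
    qed
    then have "(\<lambda>s. ereal (real s / (real M + real s * (real m - 1)))) \<longlonglongrightarrow> ereal (1 / (real m - 1))"
      by simp
    moreover have "ereal (real s / (real M + real s * (real m - 1))) \<le> lambda_exp N \<zeta>" if "s \<ge> 1" for s
      using lb[OF that] assms(2) by (simp add: M_def of_nat_diff add.assoc)
    ultimately have "ereal (1 / (real m - 1)) \<le> lambda_exp N \<zeta>"
      by (intro LIMSEQ_le_const2) blast+
    then show ?thesis using m by (simp add: one_ereal_def)
  qed
qed

text \<open>The lower bound comes from the infinite exponent at \<open>m\<close>. If the upper bound
  failed infinitely often, the exponent at m - 1 would be infinite, against minimality; for m = 1
  the upper bound is \<infinity>.\<close>

lemma U_index_imp_eventually_lambda_exp: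
  assumes "\<not> algebraic \<zeta>" "U_index m \<zeta>"
  shows "\<forall>\<^sub>F n in sequentially. lambda_exp n \<zeta> = 1 / ereal (real m - 1)"
proof -
  have m: "1 \<le> m" "w_exp m \<zeta> = \<infinity>" using assms(2) by (auto simp: U_index_def)
  have "\<forall>\<^sub>F n in sequentially. 1 / ereal (real m - 1) \<le> lambda_exp n \<zeta>"
    using eventually_ge_at_top[of m] by eventually_elim (use lambda_exp_ge_of_w_exp_infinite assms(1) m in blast)
  moreover have "\<forall>\<^sub>F n in sequentially. lambda_exp n \<zeta> \<le> 1 / ereal (real m - 1)"
  proof (cases "m = 1")
    case False
    then have m1: "1 \<le> m - 1" using m by simp
    then have "w_exp (m - 1) \<zeta> \<noteq> \<infinity>" using assms(2) by (auto simp: U_index_def)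
    then have "\<not> (\<exists>\<^sub>F n in sequentially. ereal (1 / real (m - 1)) < lambda_exp n \<zeta>)"
      using w_exp_infinite_of_frequently_lambda_exp_large[OF assms(1) m1] by blast
    moreover have "ereal (1 / real (m - 1)) = 1 / ereal (real m - 1)"
      using False m by (simp add: one_ereal_def of_nat_diff)
    ultimately show ?thesis by (simp add: not_frequently not_less)
  qed (simp add: divide_ereal_def flip: zero_ereal_def)
  ultimately show ?thesis by eventually_elim (rule antisym)
qed

lemma U_number_iff_lim_lambda_exp_pos:
  assumes "\<not> algebraic \<zeta>"
  shows "U_number \<zeta> \<longleftrightarrow> lim (\<lambda>n. lambda_exp n \<zeta>) > 0"
proof
  assume "U_number \<zeta>"
  then obtain m where m: "1 \<le> m" "U_index m \<zeta>" by (auto simp: U_number_def)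
  have "(\<lambda>n. lambda_exp n \<zeta>) \<longlonglongrightarrow> 1 / ereal (real m - 1)"
    using U_index_imp_eventually_lambda_exp[OF assms m(2)] by (rule tendsto_eventually)
  then have "lim (\<lambda>n. lambda_exp n \<zeta>) = 1 / ereal (real m - 1)" by (rule limI)
  moreover have "1 / ereal (real m - 1) > 0"
    using m(1) by (cases "m = 1") (auto simp: one_ereal_def zero_ereal_def)
  ultimately show "lim (\<lambda>n. lambda_exp n \<zeta>) > 0" by simp
next
  assume "lim (\<lambda>n. lambda_exp n \<zeta>) > 0"
  then obtain a where a: "0 < ereal a" "ereal a < lim (\<lambda>n. lambda_exp n \<zeta>)" using ereal_dense2 by blast
  then obtain k where k: "1 / real (Suc k) < a" using nat_approx_posE[of a] by (auto simp: zero_ereal_def)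
  have "\<forall>\<^sub>F n in sequentially. ereal a < lambda_exp n \<zeta>"
    using order_tendstoD(1)[OF lambda_exp_tendsto_lim a(2)] .
  then have "\<forall>\<^sub>F n in sequentially. ereal (1 / real (Suc k)) < lambda_exp n \<zeta>"
  proof eventually_elim
    case (elim n)
    have "ereal (1 / real (Suc k)) < ereal a" using k by simp
    then show ?case using elim by (rule less_trans)
  qed
  then have "w_exp (Suc k) \<zeta> = \<infinity>"
    using w_exp_infinite_of_frequently_lambda_exp_large[OF assms, of "Suc k"]
    by (simp add: eventually_frequently)
  then show "U_number \<zeta>" unfolding U_number_iff by (intro exI[of _ "Suc k"]) auto
qed

section \<open>S-numbers\<close>

text \<open>For \<open>m\<close> proportional to \<open>N\<close>, linear growth keeps the exponent
  at \<open>m\<close> below N - m - 1, so by contraposition of (A)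
  \<open>lambda_exp N \<zeta>\<close> is at most 1 / m, which is of order 1 / N.\<close>

lemma S_number_imp_limsup_lambda_exp:
  assumes "\<not> algebraic \<zeta>" "S_number \<zeta>"
  shows "limsup (\<lambda>n. ereal (real n) * lambda_exp n \<zeta>) < \<infinity>"
proof -
  obtain C where C: "limsup (\<lambda>n. w_exp n \<zeta> / ereal (real n)) < ereal C"
    using assms(2) ereal_dense2 unfolding S_number_def by blast
  then obtain m0 where m0: "\<And>n. n \<ge> m0 \<Longrightarrow> w_exp n \<zeta> / ereal (real n) < ereal C"
    using Limsup_lessD[OF C] unfolding eventually_sequentially by blast
  obtain K where K: "C \<le> real K" using real_arch_simple by blast
  have "ereal (real N) * lambda_exp N \<zeta> \<le> ereal (2 * (real K + 3))" if N: "N \<ge> (K + 3) * Suc m0" for N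
  proof -
    \<comment> \<open>K + 3 leaves room for Km + 1 \<le> N - m and 2m \<le> N, while N / m stays
      below 2(K + 3).\<close>
    define m where "m = N div (K + 3)"
    have m: "m \<ge> Suc m0" unfolding m_def using N by (simp add: less_eq_div_iff_mult_less_eq mult.commute)
    have Nm: "(K + 3) * m \<le> N" unfolding m_def by simp
    have Nm': "N < (K + 3) * (m + 1)"
      unfolding m_def by (metis Suc_eq_plus1 add_gr_0 dividend_less_times_div mult_Suc_right zero_less_numeral add.commute)
    have "w_exp m \<zeta> / ereal (real m) < ereal C" using m0 m by simp
    then have "w_exp m \<zeta> < ereal C * ereal (real m)" using m by (simp add: ereal_divide_less_iff mult.commute)
    also have "\<dots> \<le> ereal (real K * real m)" using K by (simp add: mult_right_mono)
    also have "\<dots> \<le> ereal (real (N - m) - 1)"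
    proof -
      have "K * m + 1 + m \<le> (K + 3) * m" using m by (simp add: algebra_simps)
      then have "K * m + 1 \<le> N - m" using Nm by linarith
      then have "real (K * m + 1) \<le> real (N - m)" by (rule of_nat_mono)
      then show ?thesis by simp
    qed
    finally have "\<not> ereal (real (N - m) - 1) \<le> w_exp m \<zeta>" by simp
    moreover have "2 * m \<le> N" using Nm by (simp add: algebra_simps)
    ultimately have "lambda_exp N \<zeta> \<le> ereal (1 / real m)"
      using lambda_exp_large_imp_w_exp_large[OF assms(1), of m N] m by force
    then have "ereal (real N) * lambda_exp N \<zeta> \<le> ereal (real N) * ereal (1 / real m)"
      by (intro ereal_mult_left_mono) auto
    also have "\<dots> \<le> ereal (2 * (real K + 3))"
    proof -
      have "(K + 3) * (m + 1) \<le> (K + 3) * (2 * m)" using m by (intro mult_left_mono) auto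
      then have "N \<le> (K + 3) * (2 * m)" using Nm' by linarith
      then have "real N \<le> real ((K + 3) * (2 * m))" by (rule of_nat_mono)
      then show ?thesis using m by (simp add: field_simps)
    qed
    finally show ?thesis .
  qed
  then have "\<forall>\<^sub>F N in sequentially. ereal (real N) * lambda_exp N \<zeta> \<le> ereal (2 * (real K + 3))"
    unfolding eventually_sequentially by blast
  then have "limsup (\<lambda>N. ereal (real N) * lambda_exp N \<zeta>) \<le> ereal (2 * (real K + 3))"
    by (rule Limsup_bounded)
  then show ?thesis using le_less_trans by force
qed

text \<open>If the exponent at some large \<open>m\<close> exceeds 2am, then (B) with N = am and s =
  a gives a lower bound of a / (2N) for \<open>lambda_exp N \<zeta>\<close>. Since a / 2 \<ge> c,
  this contradicts the bound \<open>c\<close>.\<close>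

lemma limsup_lambda_exp_imp_S_number:
  assumes "\<not> algebraic \<zeta>" "limsup (\<lambda>n. ereal (real n) * lambda_exp n \<zeta>) < \<infinity>"
  shows "S_number \<zeta>"
proof (rule ccontr)
  assume "\<not> S_number \<zeta>"
  then have inf: "limsup (\<lambda>n. w_exp n \<zeta> / ereal (real n)) = \<infinity>" by (simp add: S_number_def)
  obtain c where c: "limsup (\<lambda>n. ereal (real n) * lambda_exp n \<zeta>) < ereal c"
    using assms(2) ereal_dense2 by blast
  obtain n0 where n0: "\<And>n. n \<ge> n0 \<Longrightarrow> ereal (real n) * lambda_exp n \<zeta> < ereal c"
    using Limsup_lessD[OF c] unfolding eventually_sequentially by blast
  obtain a where a: "real a \<ge> max 1 (2 * c)" using real_arch_simple by blast
  have "\<exists>m \<ge> n0 + 1. ereal (2 * real a) < w_exp m \<zeta> / ereal (real m)"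
  proof (rule ccontr)
    assume "\<not> ?thesis"
    then have "\<forall>\<^sub>F m in sequentially. w_exp m \<zeta> / ereal (real m) \<le> ereal (2 * real a)"
      unfolding eventually_sequentially by (meson not_le)
    then have "limsup (\<lambda>n. w_exp n \<zeta> / ereal (real n)) \<le> ereal (2 * real a)" by (rule Limsup_bounded)
    then show False using inf by simp
  qed
  then obtain m where m: "m \<ge> n0 + 1" "ereal (2 * real a) < w_exp m \<zeta> / ereal (real m)" by blast
  define N where "N = a * m"
  have a1: "a \<ge> 1" using a by simp
  have mN: "m \<le> N" unfolding N_def using a1 by simp
  have "ereal (real (N - m + 1 + m * a)) \<le> ereal (2 * real a) * ereal (real m)"
  proof -
    have "N - m + 1 \<le> N" using m(1) mN by simp
    then have "N - m + 1 + m * a \<le> 2 * a * m" by (simp add: N_def)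
    then have "real (N - m + 1 + m * a) \<le> real (2 * a * m)" by (rule of_nat_mono)
    then show ?thesis by simp
  qed
  also have "\<dots> < w_exp m \<zeta>" using m by (simp add: ereal_less_divide_iff mult.commute)
  finally have "ereal (real a / real (N - m + 1 + a * (m - 1))) \<le> lambda_exp N \<zeta>"
    using assms(1) m mN a1 by (intro w_exp_large_imp_lambda_exp_large) auto
  then have "ereal (real N) * ereal (real a / real (N - m + 1 + a * (m - 1))) \<le> ereal (real N) * lambda_exp N \<zeta>"
    by (intro ereal_mult_left_mono) auto
  also have "\<dots> < ereal c" using n0 m mN by simp
  finally have "real N * (real a / real (N - m + 1 + a * (m - 1))) < c" by simp
  moreover have "real a / 2 \<le> real N * (real a / real (N - m + 1 + a * (m - 1)))"
  proof -
    have "N - m + 1 \<le> N" using m(1) mN by linarith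
    moreover have "a * (m - 1) \<le> N" by (simp add: N_def)
    ultimately have "N - m + 1 + a * (m - 1) \<le> 2 * N" by linarith
    moreover define t where "t = real (N - m + 1 + a * (m - 1))"
    ultimately have t: "0 < t" "t \<le> 2 * real N" by linarith+
    then have "real a * t \<le> real a * (2 * real N)" by (intro mult_left_mono) auto
    then show ?thesis unfolding t_def[symmetric] using t by (simp add: field_simps)
  qed
  ultimately show False using a by linarith
qed

theorem theorem2p1:
  fixes \<zeta> :: real
  assumes "\<not> algebraic \<zeta>"
  shows "(U_number \<zeta> \<longleftrightarrow> lim (\<lambda>n. lambda_exp n \<zeta>) > 0)
    \<and> (\<forall>m. U_index m \<zeta> \<longrightarrow>
          (\<forall>\<^sub>F n in sequentially. lambda_exp n \<zeta> = 1 / ereal (real m - 1)))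
    \<and> (T_number \<zeta> \<longleftrightarrow>
          lim (\<lambda>n. lambda_exp n \<zeta>) = 0 \<and>
          limsup (\<lambda>n. ereal (real n) * lambda_exp n \<zeta>) = \<infinity>)
    \<and> (S_number \<zeta> \<longleftrightarrow> limsup (\<lambda>n. ereal (real n) * lambda_exp n \<zeta>) < \<infinity>)"
proof -
  have U: "U_number \<zeta> \<longleftrightarrow> lim (\<lambda>n. lambda_exp n \<zeta>) > 0"
    by (rule U_number_iff_lim_lambda_exp_pos[OF assms])
  have S: "S_number \<zeta> \<longleftrightarrow> limsup (\<lambda>n. ereal (real n) * lambda_exp n \<zeta>) < \<infinity>"
    using S_number_imp_limsup_lambda_exp limsup_lambda_exp_imp_S_number assms by blast
  \<comment> \<open>Finiteness of all exponents negates U, and an infinite upper limit negates S. As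
    the limit of \<open>lambda_exp\<close> is nonnegative, not being positive means being 0.\<close>
  have "T_number \<zeta> \<longleftrightarrow> \<not> U_number \<zeta> \<and> \<not> S_number \<zeta>"
    unfolding T_number_def S_number_def U_number_iff by auto
  then have "T_number \<zeta> \<longleftrightarrow> lim (\<lambda>n. lambda_exp n \<zeta>) = 0 \<and>
          limsup (\<lambda>n. ereal (real n) * lambda_exp n \<zeta>) = \<infinity>"
    unfolding U S using lambda_exp_lim_nonneg[of \<zeta>] by auto
  then show ?thesis using U S U_index_imp_eventually_lambda_exp[OF assms] by blast
qed

end
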